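(* Let $k\ge2$ and $d\ge1$ be integers. Then $$\lim_{n\to\infty}\widehat J^{\,d,n}_{p_k}(X)=H_d(X),$$ uniformly for $X$ in compact subsets of $\mathbb R$, where $\widehat J^{\,d,n}_{p_k}$ are the renormalized Jensen polynomials of the $k$-regular partition function $p_k(n)$ and $H_d$ is the $d$-th Hermite polynomial.
   Context: $p_k(n)$ is the number of $k$-regular partitions of $n$, i.e. partitions of $n$ with no part divisible by $k$; $\sum_{n\ge0}p_k(n)q^n=\prod_{n\ge1}\frac{1-q^{kn}}{1-q^n}$. The Jensen polynomial of degree $d$ and shift $n$ is $J^{d,n}_{p_k}(X)=\sum_{j=0}^d\binom djp_k(n+j)X^j$. With $m_k=\frac{k-1}{24k}$, set (for the fixed $d$) $$A_k(n)=2\pi\sqrt{\frac{m_k}n}+\frac34\sum_{r=1}^{\lfloor3d/4\rfloor}\frac{(-1)^r}{r\,n^r},\qquad \delta_k(n)=\left(-\sum_{r=2}^\infty\frac{4\pi\sqrt{m_k}\binom{1/2}r}{n^{r-1/2}}\right)^{1/2},$$ and $$\widehat J^{\,d,n}_{p_k}(X)=\frac{\delta_k(n)^{-d}}{p_k(n)}J^{d,n}_{p_k}\left(\frac{\delta_k(n)X-1}{\exp(A_k(n))}\right).$$ The Hermite polynomials are normalized by $\sum_{d\ge0}H_d(X)\frac{u^d}{d!}=e^{-u^2+Xu}$ (so $H_1=X$, $H_2=X^2-2$). *)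

theory Defs
  imports "HOL-Analysis.Analysis" "HOL-Library.Multiset"
begin

definition regular_partitions :: "nat \<Rightarrow> nat \<Rightarrow> nat multiset set" where
  "regular_partitions k n =
     {M. (\<Sum>\<^sub># M) = n \<and> (\<forall>i \<in># M. i \<ge> 1 \<and> \<not> k dvd i)}"

definition num_regular_partitions :: "nat \<Rightarrow> nat \<Rightarrow> nat" where
  "num_regular_partitions k n = card (regular_partitions k n)"

definition jensen_poly :: "(nat \<Rightarrow> real) \<Rightarrow> nat \<Rightarrow> nat \<Rightarrow> real poly" where
  "jensen_poly \<alpha> d n = (\<Sum>j=0..d. monom (real (d choose j) * \<alpha> (n + j)) j)"

definition m_const :: "nat \<Rightarrow> real" where
  "m_const k = (real k - 1) / (24 * real k)"

definition A_seq :: "nat \<Rightarrow> nat \<Rightarrow> nat \<Rightarrow> real" where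
  "A_seq k d n = 2 * pi * sqrt (m_const k / real n)
     + 3 / 4 * (\<Sum>r = 1..(3 * d) div 4. (-1) ^ r / (real r * real n ^ r))"

text \<open>The series over \<open>r \<ge> 2\<close> is indexed by \<open>r + 2\<close> with \<open>r \<ge> 0\<close>.\<close>

definition delta_seq :: "nat \<Rightarrow> nat \<Rightarrow> real" where
  "delta_seq k n = sqrt (- (\<Sum>r. 4 * pi * sqrt (m_const k) * ((1/2) gchoose (r + 2))
                                / real n powr (real (r + 2) - 1/2)))"

definition renormalized_jensen :: "nat \<Rightarrow> nat \<Rightarrow> nat \<Rightarrow> real \<Rightarrow> real" where
  "renormalized_jensen k d n X =
     delta_seq k n powi (- int d) / real (num_regular_partitions k n) *
     poly (jensen_poly (\<lambda>i. real (num_regular_partitions k i)) d n)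
          ((delta_seq k n * X - 1) / exp (A_seq k d n))"

text \<open>
  \<open>hermite d X\<close> is \<open>d!\<close> times the coefficient of \<open>u ^ d\<close> in the formal power series
  \<open>exp (X * u - u ^ 2)\<close>.  This is not the physicists' or the probabilists' normalization.
\<close>

definition hermite :: "nat \<Rightarrow> real \<Rightarrow> real" where
  "hermite d X = fact d *
     fps_nth (fps_compose (fps_exp 1) (fps_const X * fps_X - fps_X ^ 2)) d"

lemma finite_regular_partitions: "finite (regular_partitions k n)"
proof -
  have "regular_partitions k n \<subseteq> mset ` {xs. set xs \<subseteq> {1..n} \<and> length xs \<le> n}"
  proof
    fix M assume "M \<in> regular_partitions k n"
    then have s: "\<Sum>\<^sub># M = n" and p: "\<forall>i\<in>#M. i \<ge> 1"
      by (auto simp: regular_partitions_def)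
    obtain xs where xs: "M = mset xs" by (metis ex_mset)
    have sum: "sum_list xs = n" using s xs by (simp add: sum_mset_sum_list)
    have "set xs \<subseteq> {1..n}"
      using p xs sum member_le_sum_list by fastforce
    moreover have "length xs \<le> sum_list xs"
      using p xs by (induction xs arbitrary: M) fastforce+
    ultimately show "M \<in> mset ` {xs. set xs \<subseteq> {1..n} \<and> length xs \<le> n}"
      using xs sum by auto
  qed
  then show ?thesis
    by (rule finite_subset) (intro finite_imageI finite_lists_length_le, simp)
qed

lemma delta_seq_summable:
  assumes "n \<ge> 2"
  shows "summable (\<lambda>r. 4 * pi * sqrt (m_const k) * ((1/2) gchoose (r + 2))
                          / real n powr (real (r + 2) - 1/2))"
proof -
  have "summable (\<lambda>r. ((1/2) gchoose r) * 1 ^ r * real n powr (1/2 - real r))"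
    by (rule sums_summable, rule gen_binomial_real') (use assms in auto)
  then have "summable (\<lambda>r. ((1/2) gchoose (r + 2)) * real n powr (1/2 - real (r + 2)))"
    by (subst (asm) summable_iff_shift[of _ 2, symmetric]) simp
  then have "summable (\<lambda>r. (4 * pi * sqrt (m_const k)) *
               (((1/2) gchoose (r + 2)) * real n powr (1/2 - real (r + 2))))"
    by (rule summable_mult)
  moreover have "real n powr (1/2 - x) = 1 / real n powr (x - 1/2)" for x
    using powr_minus_divide[of "real n" "x - 1/2"] by simp
  ultimately show ?thesis
    by (simp only: times_divide_eq_right mult_1_right mult.assoc)
qed

lemma hermite_0: "hermite 0 X = 1"
  by (simp add: hermite_def)

lemma hermite_1: "hermite 1 X = X"
  by (simp add: hermite_def fps_compose_nth)

lemma hermite_2: "hermite 2 X = X ^ 2 - 2"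
  by (simp add: hermite_def fps_compose_nth numeral_2_eq_2 fps_mult_nth)

lemma hermite_rec:
  "hermite (Suc (Suc d)) X = X * hermite (Suc d) X - 2 * real (Suc d) * hermite d X"
proof -
  define G :: "real fps" where "G = fps_const X * fps_X - fps_X ^ 2"
  define F where "F = fps_compose (fps_exp 1) G"
  have "fps_deriv F = F * fps_deriv G"
    unfolding F_def by (subst fps_compose_deriv) (simp_all add: G_def)
  also have "fps_deriv G = fps_const X - 2 * fps_X"
    by (simp add: G_def fps_deriv_power)
  finally have "fps_deriv F = fps_const X * F - fps_const 2 * (fps_X * F)"
    by (simp add: algebra_simps numeral_fps_const)
  then have "fps_nth (fps_deriv F) (Suc d) =
             fps_nth (fps_const X * F - fps_const 2 * (fps_X * F)) (Suc d)"
    by (rule arg_cong)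
  then have "real (Suc (Suc d)) * fps_nth F (Suc (Suc d)) = X * fps_nth F (Suc d) - 2 * fps_nth F d"
    by simp
  then have "fact (Suc d) * (real (Suc (Suc d)) * fps_nth F (Suc (Suc d))) =
             fact (Suc d) * (X * fps_nth F (Suc d) - 2 * fps_nth F d)"
    by simp
  then show ?thesis
    unfolding hermite_def F_def G_def by (simp add: algebra_simps)
qed

end

theory Submission
  imports Defs "HOL-Complex_Analysis.Complex_Analysis" "HOL-Probability.Probability"
    "HOL-Real_Asymp.Real_Asymp"
begin

text \<open>
  The circle method at leading order suffices, because forming the Jensen polynomial commutes with
  the Cauchy integral. Let \<open>F(q)\<close> be the generating function of the \<open>p\<^sub>k(n)\<close>, and write \<open>a\<close> for
  \<open>A\<^sub>k(n)\<close> and \<open>\<delta>\<close> for \<open>\<delta>\<^sub>k(n)\<close>. Integrating over \<open>q = exp (-a + i \<theta>)\<close>, the renormalized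
  polynomial is the quotient of the integrals over \<open>[-\<pi>, \<pi>]\<close> of
  \<open>F(q) exp (-i n \<theta>) ((1 + (\<delta> X - 1) exp (-i \<theta>)) / \<delta>)^d\<close> and of \<open>F(q) exp (-i n \<theta>)\<close>.
  After the substitution \<open>\<theta> = \<delta> t\<close> the \<open>d\<close>-th power tends to \<open>(X + i t)^d\<close> and the normalized weight
  \<open>F(q) exp (-i n \<theta>) / F(exp (-a))\<close> tends to \<open>exp (- t\<^sup>2 / 4)\<close>, and the mean of \<open>(X + i t)^d\<close> under
  this Gaussian is \<open>H\<^sub>d(X)\<close>. Dominated convergence applies because
  \<open>log (F(\<bar>q\<bar>) / \<bar>F(q)\<bar>)\<close> is at least a constant times the minimum of \<open>\<theta>\<^sup>2 / a^3\<close> and \<open>1 / a\<close>.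
\<close>

section \<open>Counting partitions by Cauchy integrals\<close>

text \<open>The obstacle is the factor \<open>\<delta> powi (- d)\<close>: treating the ratios
  p_k(n+j) / p_k(n) one by one would mean following their cancellations down to order
  \<open>\<delta> ^ d\<close>. Under the integral they are explicit. With
  \<open>c = cis (- \<theta>)\<close> one has
  \<open>1 + (\<delta> * X - 1) * c = (1 - c) + \<delta> * X * c\<close>, and both summands have
  order \<delta> on the scale \<open>\<theta> = \<delta> * t\<close>. With radius exactly
  \<open>exp (- a)\<close> the powers of \<open>exp a\<close> cancel exactly, and
  \<open>F(exp (- a))\<close> drops out of the quotient, so all that matters is how log F varies
  along the circle. Constants: the singular part of log F(exp(-s)) is \<kappa>/s with \<kappa> =
  \<open>log_gf_leading k\<close>, which is 4 \<pi>^2 m_k. The function \<kappa>/a + n a is least at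
  a = 2 \<pi> sqrt(m_k/n), the leading term of A_k(n); the other terms of A_k(n) are O(1/n), hence
  o(\<delta>), since \<delta> has order n^(-3/4). The quadratic part of the exponent is -\<kappa>
  \<theta>^2/a^3, and \<delta>^2 ~ a^3/(4 \<kappa>) turns it into -t^2/4, a Gaussian of variance 2,
  as the normalization of \<open>hermite\<close> demands.\<close>

definition partitions_from :: "nat set \<Rightarrow> nat \<Rightarrow> nat multiset set" where
  "partitions_from S n = {M. \<Sum>\<^sub># M = n \<and> set_mset M \<subseteq> S}"

lemma finite_partitions_from:
  assumes "0 \<notin> S"
  shows "finite (partitions_from S n)"
proof (rule finite_subset)
  \<comment> \<open>\<open>0 dvd i\<close> means \<open>i = 0\<close>, so
    \<open>regular_partitions 0 n\<close> is the set of all partitions of \<open>n\<close>.\<close>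
  show "partitions_from S n \<subseteq> regular_partitions 0 n"
  proof
    fix M assume M: "M \<in> partitions_from S n"
    have "i \<ge> 1 \<and> \<not> 0 dvd i" if "i \<in># M" for i
      using that M assms by (cases i) (auto simp: partitions_from_def)
    then show "M \<in> regular_partitions 0 n"
      using M by (auto simp: partitions_from_def regular_partitions_def)
  qed
qed (rule finite_regular_partitions)

lemma partitions_from_insert:
  "partitions_from (insert m S) n =
     partitions_from S n \<union> (if m \<le> n then add_mset m ` partitions_from (insert m S) (n - m) else {})"
  (is "?L = ?R")
proof
  show "?L \<subseteq> ?R"
  proof
    fix M assume M: "M \<in> ?L"
    show "M \<in> ?R"
    proof (cases "m \<in># M")
      case True
      then obtain M' where M': "M = add_mset m M'"
        by (metis insert_DiffM)
      then have "m \<le> n" "M' \<in> partitions_from (insert m S) (n - m)"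
        using M by (auto simp: partitions_from_def)
      then show ?thesis using M' by auto
    next
      case False
      then show ?thesis using M by (auto simp: partitions_from_def)
    qed
  qed
qed (auto simp: partitions_from_def split: if_splits)

text \<open>Splitting by whether the part \<open>m\<close> occurs gives a recurrence for the counts,
  and in terms of series it says that multiplication by \<open>1 - fps_X ^ m\<close> removes
  \<open>m\<close> from the set of allowed parts.\<close>

lemma fps_prod_inverse_nth:
  assumes "finite S" "0 \<notin> S"
  shows "fps_nth (\<Prod>m\<in>S. inverse (1 - fps_X ^ m)) n = (of_nat (card (partitions_from S n)) :: complex)"
  using assms
proof (induction S arbitrary: n)
  case empty
  have "partitions_from {} n = (if n = 0 then {{#}} else {})"
    by (auto simp: partitions_from_def)
  then show ?case by simp
next
  case (insert m S)
  define c where "c = (\<lambda>S. Abs_fps (\<lambda>n. of_nat (card (partitions_from S n)) :: complex))"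
  have m: "m > 0" "m \<notin> S" using insert.prems insert.hyps by auto
  have IH: "(\<Prod>m\<in>S. inverse (1 - fps_X ^ m)) = c S"
    using insert by (auto simp: c_def fps_eq_iff)
  have card: "card (partitions_from (insert m S) n) = card (partitions_from S n) +
      (if m \<le> n then card (partitions_from (insert m S) (n - m)) else 0)" for n
  proof (cases "m \<le> n")
    case True
    have "partitions_from (insert m S) n =
        partitions_from S n \<union> add_mset m ` partitions_from (insert m S) (n - m)"
      using True by (subst partitions_from_insert) auto
    also have "card \<dots> = card (partitions_from S n) +
        card (add_mset m ` partitions_from (insert m S) (n - m))"
    proof (rule card_Un_disjoint)
      show "finite (partitions_from S n)" "finite (add_mset m ` partitions_from (insert m S) (n - m))"
        using insert.prems by (auto intro!: finite_imageI finite_partitions_from)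
      have "m \<notin># M" if "M \<in> partitions_from S n" for M
        using that m by (auto simp: partitions_from_def)
      then show "partitions_from S n \<inter> add_mset m ` partitions_from (insert m S) (n - m) = {}"
        by fastforce
    qed
    also have "card (add_mset m ` partitions_from (insert m S) (n - m)) =
        card (partitions_from (insert m S) (n - m))"
      by (rule card_image) (auto simp: inj_on_def)
    finally show ?thesis using True by simp
  next
    case False
    then show ?thesis by (subst partitions_from_insert) auto
  qed
  have "c (insert m S) * (1 - fps_X ^ m) = c S"
    by (auto simp: fps_eq_iff c_def fps_X_power_mult_right_nth right_diff_distrib card)
  moreover have "(1 - fps_X ^ m :: complex fps) * inverse (1 - fps_X ^ m) = 1"
    using m by (intro inverse_mult_eq_1') simp
  ultimately have "c (insert m S) = c S * inverse (1 - fps_X ^ m)"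
    by (metis mult.assoc mult.right_neutral)
  then have "(\<Prod>m\<in>insert m S. inverse (1 - fps_X ^ m)) = c (insert m S)"
    using insert.hyps IH by (simp add: mult.commute)
  then show ?case by (simp add: c_def)
qed

text \<open>Cutting at a multiple of \<open>k\<close> makes the sum of \<open>z ^ m\<close> over
  this set factor exactly as \<open>1 - z ^ (k * N)\<close> times its limit. Removing the multiples
  also removes 0.\<close>

definition truncated_parts :: "nat \<Rightarrow> nat \<Rightarrow> nat set" where
  "truncated_parts k N = {..<k * N} - (\<lambda>j. k * j) ` {..<N}"

lemma truncated_parts_iff:
  assumes "k \<ge> 1"
  shows "m \<in> truncated_parts k N \<longleftrightarrow> m < k * N \<and> \<not> k dvd m"
  using assms by (auto simp: truncated_parts_def elim!: dvdE)

lemma num_regular_partitions_truncated: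
  assumes "k \<ge> 1" "n < N"
  shows "num_regular_partitions k n = card (partitions_from (truncated_parts k N) n)"
proof -
  have "regular_partitions k n = partitions_from (truncated_parts k N) n"
  proof (intro set_eqI iffI)
    fix M assume "M \<in> regular_partitions k n"
    then have s: "\<Sum>\<^sub># M = n" and p: "\<And>i. i \<in># M \<Longrightarrow> i \<ge> 1 \<and> \<not> k dvd i"
      by (auto simp: regular_partitions_def)
    have "i < k * N" if "i \<in># M" for i
    proof -
      have "i \<le> n" using that s by (auto dest!: multi_member_split)
      also have "n < 1 * N" using assms by simp
      also have "\<dots> \<le> k * N" using assms by (intro mult_right_mono) auto
      finally show ?thesis .
    qed
    then show "M \<in> partitions_from (truncated_parts k N) n"
      using s p assms by (auto simp: partitions_from_def truncated_parts_iff)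
  next
    fix M assume "M \<in> partitions_from (truncated_parts k N) n"
    then show "M \<in> regular_partitions k n"
      using assms by (force simp: partitions_from_def truncated_parts_iff regular_partitions_def
          Suc_le_eq intro: Nat.gr0I)
  qed
  then show ?thesis by (simp add: num_regular_partitions_def)
qed

lemma norm_power_less_1:
  fixes z :: "'a :: real_normed_div_algebra"
  assumes "norm z < 1" "m > 0"
  shows "norm (z ^ m) < 1"
  using assms by (simp add: norm_power power_less_one_iff)

lemma one_minus_power_nonzero:
  fixes z :: complex
  assumes "norm z < 1" "m > 0"
  shows "1 - z ^ m \<noteq> 0"
  using norm_power_less_1[OF assms] by auto

lemma Cauchy_coefficient:
  fixes f :: "complex \<Rightarrow> complex"
  assumes f: "f has_fps_expansion F" and holo: "f holomorphic_on ball 0 1" and r: "0 < r" "r < 1"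
  shows "((\<lambda>\<theta>. f (of_real r * cis \<theta>) / (of_real r * cis \<theta>) ^ n) has_integral 2 * pi * fps_nth F n) {-pi..pi}"
proof -
  \<comment> \<open>Library circles start at angle 0; precomposing with negation moves the range to \<open>{-pi..pi}\<close>.\<close>
  define h where "h = (\<lambda>z. f (- 1 * z))"
  have holo_h: "h holomorphic_on ball 0 1"
    unfolding h_def by (rule holomorphic_on_compose_gen[OF _ holo, unfolded o_def]) (auto intro!: holomorphic_intros)
  have "(deriv ^^ n) h 0 = (- 1) ^ n * (deriv ^^ n) f 0"
    unfolding h_def
    by (subst higher_deriv_compose_linear[OF holo, where S = "ball 0 1"]) auto
  also have "(deriv ^^ n) f 0 = fact n * fps_nth F n"
    using fps_nth_fps_expansion[OF f, of n] by simp
  finally have deriv: "(deriv ^^ n) h 0 = (- 1) ^ n * (fact n * fps_nth F n)" .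
  have "((\<lambda>u. h u / (u - 0) ^ Suc n) has_contour_integral 2 * pi * \<i> / fact n * (deriv ^^ n) h 0)
      (circlepath 0 r)"
    using r by (intro Cauchy_has_contour_integral_higher_derivative_circlepath
        holomorphic_on_imp_continuous_on holomorphic_on_subset[OF holo_h]) auto
  then have "((\<lambda>t. h (of_real r * cis t) / (of_real r * cis t) ^ Suc n * r * \<i> * cis t)
      has_integral 2 * pi * \<i> / fact n * (deriv ^^ n) h 0) {0..2 * pi}"
    unfolding circlepath_def by (subst (asm) has_contour_integral_part_circlepath_iff) auto
  from has_integral_mult_right[OF this, of "(-1) ^ n / \<i>"]
  have scaled: "((\<lambda>t. (- 1) ^ n / \<i> * (h (of_real r * cis t) / (of_real r * cis t) ^ Suc n * r * \<i> * cis t))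
      has_integral 2 * pi * fps_nth F n) {0..2 * pi}"
  proof (rule has_integral_eq_rhs)
    have "(- 1) ^ n * (- 1) ^ n = (1 :: complex)"
      by (simp flip: power_mult_distrib)
    then show "complex_of_real (2 * pi) * fps_nth F n =
        (- 1) ^ n / \<i> * (complex_of_real (2 * pi) * \<i> / fact n * (deriv ^^ n) h 0)"
      by (simp add: deriv mult_ac)
  qed
  have cancel: "(- 1) ^ n / \<i> * (x / y ^ Suc n * r * \<i> * c) = x / (- y) ^ n"
    if y: "y = of_real r * c" and c: "c \<noteq> 0" for x y c :: complex
  proof -
    have y0: "y \<noteq> 0" using that r by simp
    have "(- 1) ^ n / \<i> * (x / y ^ Suc n * r * \<i> * c) = (- 1) ^ n * x * ((of_real r * c) / y ^ Suc n)"
      by (simp only: divide_inverse ) (simp add: mult_ac)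
    also have "(of_real r * c) / y ^ Suc n = 1 / y ^ n"
      unfolding y[symmetric] using y0 by simp
    also have "(- 1) ^ n * x * (1 / y ^ n) = x / (- y) ^ n"
      by (cases "even n") auto
    finally show ?thesis .
  qed
  have "((\<lambda>t. h (of_real r * cis t) / (- (of_real r * cis t)) ^ n) has_integral 2 * pi * fps_nth F n) {0..2 * pi}"
    by (rule has_integral_eq[OF _ scaled], rule cancel) auto
  from has_integral_shift_real_ivl[OF this, of pi]
  have "((\<lambda>t. h (of_real r * cis (t + pi)) / (- (of_real r * cis (t + pi))) ^ n) has_integral 2 * pi * fps_nth F n)
       {- pi..pi}"
    by simp
  moreover have "cis (t + pi) = - cis t" for t
    by (simp add: complex_eq_iff)
  ultimately show ?thesis
    by (simp add: h_def)
qed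

text \<open>The sum of \<open>z ^ m\<close> over all \<open>m\<close> not divisible by \<open>k\<close>, see \<open>tendsto_sum_truncated_parts\<close>.\<close>

definition geo_diff :: "nat \<Rightarrow> complex \<Rightarrow> complex" where
  "geo_diff k z = 1 / (1 - z) - 1 / (1 - z ^ k)"

lemma sum_truncated_parts:
  assumes "k \<ge> 1" "norm z < 1"
  shows "(\<Sum>m\<in>truncated_parts k N. z ^ m) = (1 - z ^ (k * N)) * geo_diff k z"
proof -
  have nz: "z \<noteq> 1" "z ^ k \<noteq> 1"
    using assms one_minus_power_nonzero[of z 1] one_minus_power_nonzero[of z k] by auto
  have sub: "(\<lambda>j. k * j) ` {..<N} \<subseteq> {..<k * N}"
    using assms by auto
  have "(\<Sum>m\<in>truncated_parts k N. z ^ m) =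
      (\<Sum>m<k * N. z ^ m) - (\<Sum>m\<in>(\<lambda>j. k * j) ` {..<N}. z ^ m)"
    unfolding truncated_parts_def by (rule sum_diff) (use sub in auto)
  also have "(\<Sum>m\<in>(\<lambda>j. k * j) ` {..<N}. z ^ m) = (\<Sum>j<N. (z ^ k) ^ j)"
    using assms by (subst sum.reindex) (auto simp: inj_on_def power_mult)
  also have "(\<Sum>m<k * N. z ^ m) - \<dots> = (1 - z ^ (k * N)) * geo_diff k z"
    using nz by (simp add: sum_gp_strict geo_diff_def power_mult diff_divide_distrib right_diff_distrib)
  finally show ?thesis .
qed

lemma tendsto_sum_truncated_parts:
  assumes "k \<ge> 1" "norm z < 1"
  shows "(\<lambda>N. \<Sum>m\<in>truncated_parts k N. z ^ m) \<longlonglongrightarrow> geo_diff k z"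
proof -
  have "(\<lambda>N. (z ^ k) ^ N) \<longlonglongrightarrow> 0"
    using assms by (intro LIMSEQ_power_zero norm_power_less_1) auto
  then have "(\<lambda>N. (1 - (z ^ k) ^ N) * geo_diff k z) \<longlonglongrightarrow> (1 - 0) * geo_diff k z"
    by (intro tendsto_mult tendsto_diff tendsto_const)
  then show ?thesis
    using assms by (simp add: sum_truncated_parts power_mult)
qed

lemma geo_diff_of_real:
  "geo_diff k (of_real r) = of_real (1 / (1 - r) - 1 / (1 - r ^ k))"
  by (simp add: geo_diff_def)

text \<open>The power series has coefficients 0 and 1 only, so the triangle inequality for finite
  sums passes to the limit.\<close>

lemma norm_geo_diff_le_Re:
  assumes "k \<ge> 1" "norm z < 1"
  shows "norm (geo_diff k z) \<le> Re (geo_diff k (of_real (norm z)))"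
proof (rule LIMSEQ_le)
  show "(\<lambda>N. norm (\<Sum>m\<in>truncated_parts k N. z ^ m)) \<longlonglongrightarrow> norm (geo_diff k z)"
    by (intro tendsto_norm tendsto_sum_truncated_parts assms)
  show "(\<lambda>N. Re (\<Sum>m\<in>truncated_parts k N. of_real (norm z) ^ m)) \<longlonglongrightarrow> Re (geo_diff k (of_real (norm z)))"
    using assms by (intro tendsto_Re tendsto_sum_truncated_parts) auto
  have "norm (\<Sum>m\<in>truncated_parts k N. z ^ m) \<le> Re (\<Sum>m\<in>truncated_parts k N. of_real (norm z) ^ m)" for N
    using norm_sum[of "\<lambda>m. z ^ m" "truncated_parts k N"] by (simp add: norm_power flip: of_real_power)
  then show "\<exists>N0. \<forall>N\<ge>N0. norm (\<Sum>m\<in>truncated_parts k N. z ^ m) \<le> Re (\<Sum>m\<in>truncated_parts k N. of_real (norm z) ^ m)"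
    by blast
qed

lemma norm_geo_diff_le:
  assumes "k \<ge> 1" "norm z < 1"
  shows "norm (geo_diff k z) \<le> norm z / (1 - norm z)"
proof -
  have "norm z ^ k < 1"
    using assms by (intro power_less_one_iff[THEN iffD2]) auto
  then have "1 \<le> 1 / (1 - norm z ^ k)"
    by simp
  moreover have "1 / (1 - norm z) - 1 = norm z / (1 - norm z)"
    using assms by (simp add: field_simps)
  ultimately have "1 / (1 - norm z) - 1 / (1 - norm z ^ k) \<le> norm z / (1 - norm z)"
    by linarith
  then show ?thesis
    using norm_geo_diff_le_Re[OF assms] by (simp add: geo_diff_of_real)
qed

section \<open>The logarithm of the generating function as a Lambert-type series\<close>

lemma norm_geo_diff_power_le:
  assumes "k \<ge> 1" "norm z < 1"
  shows "norm (geo_diff k (z ^ Suc l) / of_nat (Suc l)) \<le> norm z ^ Suc l / (1 - norm z)"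
proof -
  have *: "norm (z ^ Suc l) \<le> norm z" "norm (z ^ Suc l) < 1"
    using assms by (auto simp: norm_power norm_power_less_1 mult_left_le power_le_one mult_le_one power_less_one_iff
       simp del: power_Suc intro: power_decreasing[of 1 "Suc l", simplified])
  have "norm (geo_diff k (z ^ Suc l) / of_nat (Suc l)) \<le> norm (geo_diff k (z ^ Suc l)) / 1"
    unfolding norm_divide norm_of_nat by (rule divide_left_mono) auto
  also have "\<dots> \<le> norm (z ^ Suc l) / (1 - norm (z ^ Suc l))"
    using norm_geo_diff_le[OF assms(1) *(2)] by simp
  also have "\<dots> \<le> norm (z ^ Suc l) / (1 - norm z)"
    using * assms by (intro divide_left_mono) auto
  finally show ?thesis by (simp only: norm_power)
qed

text \<open>Expanding every \<open>- ln (1 - z ^ m)\<close> in powers of \<open>z ^ m\<close> and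
  summing over \<open>m\<close> first leaves this series over the exponent. As a definition it
  avoids choosing a branch of the logarithm of the infinite product.\<close>

definition log_gf :: "nat \<Rightarrow> complex \<Rightarrow> complex" where
  "log_gf k z = (\<Sum>l. geo_diff k (z ^ Suc l) / of_nat (Suc l))"

lemma summable_geometric_bound:
  assumes "norm z < 1"
  shows "summable (\<lambda>l. norm z ^ Suc l / (1 - norm z))"
  using assms by (intro summable_divide) (simp add: summable_mult summable_geometric)

lemma summable_log_gf:
  assumes "k \<ge> 1" "norm z < 1"
  shows "summable (\<lambda>l. geo_diff k (z ^ Suc l) / of_nat (Suc l))"
  by (rule summable_comparison_test[OF _ summable_geometric_bound[OF assms(2)]])
     (use norm_geo_diff_power_le[OF assms] in blast)

lemma log_gf_sums:
  assumes "k \<ge> 1" "norm z < 1"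
  shows "(\<lambda>l. geo_diff k (z ^ Suc l) / of_nat (Suc l)) sums log_gf k z"
  unfolding log_gf_def by (rule summable_sums[OF summable_log_gf[OF assms]])

lemma prod_inverse_eq_exp:
  assumes "finite S" "0 \<notin> S" "norm (z :: complex) < 1"
  shows "(\<Prod>m\<in>S. inverse (1 - z ^ m)) = exp (\<Sum>l. (\<Sum>m\<in>S. (z ^ Suc l) ^ m) / of_nat (Suc l))"
proof -
  have sums: "(\<lambda>l. (z ^ Suc l) ^ m / of_nat (Suc l)) sums - ln (1 - z ^ m)" if "m \<in> S" for m
  proof -
    have "m > 0" using that assms by (metis gr0I)
    then have "norm (- (z ^ m)) < 1" using assms by (simp add: norm_power_less_1)
    from sums_minus[OF Ln_series'[OF this]]
    have "(\<lambda>l. (z ^ m) ^ l / of_nat l) sums - ln (1 - z ^ m)" by simp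
    \<comment> \<open>The term at \<open>l = 0\<close> is a division by zero and hence 0, so the
      index can be shifted without changing the sum.\<close>
    then have "(\<lambda>l. (z ^ m) ^ Suc l / of_nat (Suc l)) sums - ln (1 - z ^ m)"
      by (subst sums_Suc_iff) simp
    moreover have "(z ^ m) ^ Suc l = (z ^ Suc l) ^ m" for l
      by (simp only: power_mult[symmetric] mult.commute)
    ultimately show ?thesis by simp
  qed
  have "(\<lambda>l. \<Sum>m\<in>S. (z ^ Suc l) ^ m / of_nat (Suc l)) sums (\<Sum>m\<in>S. - ln (1 - z ^ m))"
    by (rule sums_sum) (rule sums)
  then have "(\<Sum>l. (\<Sum>m\<in>S. (z ^ Suc l) ^ m) / of_nat (Suc l)) = (\<Sum>m\<in>S. - ln (1 - z ^ m))"
    by (simp add: sums_iff sum_divide_distrib)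
  moreover have "exp (- ln (1 - z ^ m)) = inverse (1 - z ^ m)" if "m \<in> S" for m
  proof -
    have "1 - z ^ m \<noteq> 0"
      using that assms by (intro one_minus_power_nonzero) (auto intro: gr0I)
    then show ?thesis by (simp add: exp_minus)
  qed
  ultimately show ?thesis
    using assms by (simp add: exp_sum)
qed

text \<open>The point is uniformity in \<open>N\<close>: truncation costs only the factor
  \<open>1 - (z ^ Suc l) ^ (k * N)\<close>, of norm at most 2. The bound serves Tannery's theorem
  and, after exponentiation, dominated convergence on a circle.\<close>

lemma truncated_gf_bound:
  fixes z :: complex
  assumes "k \<ge> 1" "norm z < 1"
  shows "norm ((\<Sum>m\<in>truncated_parts k N. (z ^ Suc l) ^ m) / of_nat (Suc l)) \<le> 2 * (norm z ^ Suc l / (1 - norm z))"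
proof -
  have 1: "norm (z ^ Suc l) < 1" using assms by (intro norm_power_less_1) auto
  have "norm ((z ^ Suc l) ^ (k * N)) \<le> 1"
    unfolding norm_power[of "z ^ Suc l"] using 1 by (intro power_le_one) auto
  then have "norm (1 - (z ^ Suc l) ^ (k * N)) \<le> 2"
    using norm_triangle_ineq4[of 1 "(z ^ Suc l) ^ (k * N)"] by simp
  then have "norm (1 - (z ^ Suc l) ^ (k * N)) * norm (geo_diff k (z ^ Suc l) / of_nat (Suc l)) \<le>
      2 * (norm z ^ Suc l / (1 - norm z))"
    by (intro mult_mono norm_geo_diff_power_le assms) auto
  then show ?thesis
    unfolding sum_truncated_parts[OF assms(1) 1] by (simp only: norm_mult norm_divide times_divide_eq_right)
qed

lemma tendsto_truncated_gf:
  assumes "k \<ge> 1" "norm z < 1"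
  shows "(\<lambda>N. \<Prod>m\<in>truncated_parts k N. inverse (1 - z ^ m)) \<longlonglongrightarrow> exp (log_gf k z)"
    and "norm (\<Prod>m\<in>truncated_parts k N. inverse (1 - z ^ m)) \<le> exp (\<Sum>l. 2 * (norm z ^ Suc l / (1 - norm z)))"
proof -
  have fin: "finite (truncated_parts k N)" "0 \<notin> truncated_parts k N" for N
    using assms by (auto simp: truncated_parts_iff) (simp add: truncated_parts_def)
  have summ: "summable (\<lambda>l. 2 * (norm z ^ Suc l / (1 - norm z)))"
    using summable_geometric_bound[OF assms(2)] by (rule summable_mult)
  have "(\<lambda>N. \<Sum>l. (\<Sum>m\<in>truncated_parts k N. (z ^ Suc l) ^ m) / of_nat (Suc l)) \<longlonglongrightarrow>
      (\<Sum>l. geo_diff k (z ^ Suc l) / of_nat (Suc l))"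
  proof (rule tannerys_theorem[THEN conjunct2, THEN conjunct2, OF _ _ summ])
    show "(\<lambda>N. (\<Sum>m\<in>truncated_parts k N. (z ^ Suc l) ^ m) / of_nat (Suc l)) \<longlonglongrightarrow>
        geo_diff k (z ^ Suc l) / of_nat (Suc l)" for l
      by (intro tendsto_divide tendsto_sum_truncated_parts tendsto_const norm_power_less_1 assms)
        (auto simp del: of_nat_Suc)
    show "\<forall>\<^sub>F (l, N) in sequentially \<times>\<^sub>F sequentially.
        norm ((\<Sum>m\<in>truncated_parts k N. (z ^ Suc l) ^ m) / of_nat (Suc l)) \<le> 2 * (norm z ^ Suc l / (1 - norm z))"
      using truncated_gf_bound[OF assms] by (intro always_eventually) auto
  qed auto
  then show "(\<lambda>N. \<Prod>m\<in>truncated_parts k N. inverse (1 - z ^ m)) \<longlonglongrightarrow> exp (log_gf k z)"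
    using fin assms by (auto simp: prod_inverse_eq_exp log_gf_def intro!: tendsto_exp)
  have "Re (\<Sum>l. (\<Sum>m\<in>truncated_parts k N. (z ^ Suc l) ^ m) / of_nat (Suc l)) \<le>
      (\<Sum>l. 2 * (norm z ^ Suc l / (1 - norm z)))"
    using norm_suminf_le[OF truncated_gf_bound[OF assms, where N = N] summ] complex_Re_le_cmod order_trans by blast
  then show "norm (\<Prod>m\<in>truncated_parts k N. inverse (1 - z ^ m)) \<le> exp (\<Sum>l. 2 * (norm z ^ Suc l / (1 - norm z)))"
    using fin assms by (simp add: prod_inverse_eq_exp del: power_Suc of_nat_Suc)
qed

text \<open>For \<open>N > n\<close> the truncated product has the same coefficient at
  \<open>n\<close>, so its Cauchy integral is constant in \<open>N\<close>. Dominated convergence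
  carries this value over to the full generating function, working on one circle only.\<close>

lemma num_regular_partitions_integral:
  assumes "k \<ge> 1" "0 < r" "r < 1"
  shows "((\<lambda>\<theta>. exp (log_gf k (of_real r * cis \<theta>)) / (of_real r * cis \<theta>) ^ n) has_integral
    2 * pi * num_regular_partitions k n) {-pi..pi}"
proof -
  define f where "f = (\<lambda>N z :: complex. \<Prod>m\<in>truncated_parts k N. inverse (1 - z ^ m))"
  define I where "I = complex_of_real (2 * pi * num_regular_partitions k n)"
  define g where "g = (\<lambda>N \<theta>. f N (of_real r * cis \<theta>) / (of_real r * cis \<theta>) ^ n)"
  have norm: "norm (of_real r * cis \<theta>) = r" for \<theta> using assms by (simp add: norm_mult)
  have int: "(g N has_integral I) {-pi..pi}" if "N > n" for N
  proof -
    have fin: "finite (truncated_parts k N)" "0 \<notin> truncated_parts k N"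
      using assms by (auto simp: truncated_parts_iff) (simp add: truncated_parts_def)
    then have pos: "m > 0" if "m \<in> truncated_parts k N" for m using that by (metis gr0I)
    have "f N has_fps_expansion (\<Prod>m\<in>truncated_parts k N. inverse (1 - fps_X ^ m))"
      unfolding f_def by (intro fps_expansion_intros) (use pos in \<open>auto simp: zero_power\<close>)
    moreover have "f N holomorphic_on ball 0 1"
      unfolding f_def using pos
      by (intro holomorphic_intros) (use pos one_minus_power_nonzero in auto)
    ultimately have "(g N has_integral complex_of_real (2 * pi) *
        fps_nth (\<Prod>m\<in>truncated_parts k N. inverse (1 - fps_X ^ m)) n) {-pi..pi}"
      unfolding g_def by (rule Cauchy_coefficient[OF _ _ assms(2,3)])
    then show ?thesis
      using fin that assms by (simp add: fps_prod_inverse_nth num_regular_partitions_truncated[of k n N] I_def)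
  qed
  have shift: "(g (N + Suc n) has_integral I) {-pi..pi}" for N
    by (rule int) simp
  define h where "h = (\<lambda>\<theta>. exp (log_gf k (of_real r * cis \<theta>)) / (of_real r * cis \<theta>) ^ n)"
  have int: "g (N + Suc n) integrable_on {-pi..pi}" for N
    using shift by blast
  have int': "(\<lambda>_. exp (\<Sum>l. 2 * (r ^ Suc l / (1 - r))) / r ^ n) integrable_on {-pi..pi}"
    by (rule integrable_const_ivl)
  have bound: "norm (g (N + Suc n) \<theta>) \<le> exp (\<Sum>l. 2 * (r ^ Suc l / (1 - r))) / r ^ n" for N \<theta>
    using tendsto_truncated_gf(2)[of k "of_real r * cis \<theta>" "N + Suc n"] assms
    unfolding g_def f_def norm norm_divide norm_power by (intro divide_right_mono) auto
  have lim: "(\<lambda>N. g (N + Suc n) \<theta>) \<longlonglongrightarrow> h \<theta>" for \<theta>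
  proof (rule LIMSEQ_ignore_initial_segment)
    show "(\<lambda>N. g N \<theta>) \<longlonglongrightarrow> h \<theta>"
      unfolding g_def h_def f_def using assms
      by (intro tendsto_divide tendsto_truncated_gf(1) tendsto_const) (auto simp: norm_mult)
  qed
  note * = dominated_convergence[OF int int' bound lim]
  have "integral {-pi..pi} h = I"
    using *(2) unfolding integral_unique[OF shift] by (simp add: LIMSEQ_const_iff)
  with *(1) have "(h has_integral I) {-pi..pi}"
    by (metis integrable_integral)
  then show ?thesis unfolding h_def I_def .
qed

section \<open>The generating function near its singularity\<close>

text \<open>The expression is 4 sinh(z/2)^2. Its reciprocal is minus the derivative of
  \<open>1 / (1 - exp (- z))\<close>, and this bound keeps that reciprocal under control in the
  right half-plane.\<close>

lemma norm_exp_symmetric_ge: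
  fixes z :: complex
  assumes "Re z > 0"
  shows "norm (exp z + exp (- z) - 2) \<ge> (Re z)\<^sup>2 / 4"
proof -
  define x where "x = Re z"
  have x: "x > 0" using assms by (simp add: x_def)
  have "exp z + exp (- z) - 2 = (exp (z / 2) - exp (- z / 2))\<^sup>2"
    by (simp add: power2_eq_square algebra_simps flip: exp_add)
  then have eq: "norm (exp z + exp (- z) - 2) = (norm (exp (z / 2) - exp (- z / 2)))\<^sup>2"
    by (simp add: norm_power)
  have "x / 2 \<le> exp (x / 2) - 1"
    using exp_ge_add_one_self[of "x / 2"] by linarith
  also have "\<dots> \<le> exp (x / 2) - exp (- x / 2)"
    using x by simp
  also have "\<dots> \<le> norm (exp (z / 2) - exp (- z / 2))"
    using norm_triangle_ineq2[of "exp (z / 2)" "exp (- z / 2)"] by (simp add: x_def)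
  finally have "(x / 2)\<^sup>2 \<le> (norm (exp (z / 2) - exp (- z / 2)))\<^sup>2"
    using x by (intro power_mono) auto
  then show ?thesis
    unfolding eq by (simp add: power_divide x_def)
qed

text \<open>Odd powers cancel between \<open>exp z\<close> and \<open>exp (- z)\<close>, so the
  cubic Taylor polynomials already leave an error of fourth order.\<close>

lemma norm_exp_symmetric_Taylor:
  fixes z :: complex
  assumes "norm z \<le> 1 / 2"
  shows "norm (exp z + exp (- z) - 2 - z\<^sup>2) \<le> 2 / 3 * norm z ^ 4"
proof -
  have sum: "(\<Sum>i\<le>3. w ^ i / fact i) = 1 + w + w\<^sup>2 / 2 + w ^ 3 / 6" for w :: complex
    by (simp add: numeral_3_eq_3 power2_eq_square fact_numeral)
  have T: "norm (exp w - (1 + w + w\<^sup>2 / 2 + w ^ 3 / 6)) \<le> norm z ^ 4 / 3"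
    if "norm w = norm z" for w :: complex
  proof -
    have "norm (exp w - (1 + w + w\<^sup>2 / 2 + w ^ 3 / 6)) \<le> exp (norm w) * norm w ^ Suc 3 / fact 3"
      using Taylor_exp_field[of w 3] by (simp only: sum)
    also have "exp (norm w) \<le> 2"
      using exp_bound_half[of "norm w"] that assms by simp
    then have "exp (norm w) * norm w ^ Suc 3 / fact 3 \<le> 2 * norm w ^ Suc 3 / fact 3"
      by (intro divide_right_mono mult_right_mono) auto
    also have "\<dots> = norm z ^ 4 / 3"
      using that by (simp add: fact_numeral)
    finally show ?thesis .
  qed
  have "exp z + exp (- z) - 2 - z\<^sup>2 =
      (exp z - (1 + z + z\<^sup>2 / 2 + z ^ 3 / 6)) + (exp (- z) - (1 + (- z) + (- z)\<^sup>2 / 2 + (- z) ^ 3 / 6))"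
    by (simp add: field_simps)
  also have "norm \<dots> \<le> norm z ^ 4 / 3 + norm z ^ 4 / 3"
    by (intro norm_triangle_mono T) auto
  finally show ?thesis by simp
qed

text \<open>
  The exponent \<open>-5/4\<close> in the following estimates only has to lie strictly between \<open>-3/2\<close> and \<open>-1\<close>:
  below \<open>-1\<close> for the sum over the terms of the logarithm to converge, above \<open>-3/2\<close> because
  \<open>\<delta>\<close> has the order of \<open>a powr (3/2)\<close>.
\<close>

lemma norm_bernoulli_deriv_le:
  fixes z :: complex
  assumes "Re z > 0" "\<bar>Im z\<bar> \<le> Re z"
  shows "norm (1 / z\<^sup>2 - 1 / (exp z + exp (- z) - 2)) \<le> 20 * Re z powr (- 5 / 4)"
proof -
  define x D where "x = Re z" and "D = exp z + exp (- z) - 2"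
  have x: "x > 0" "x \<le> norm z" "norm z \<le> 2 * x" "z \<noteq> 0"
    using assms cmod_le[of z] complex_Re_le_cmod[of z] by (auto simp: x_def)
  have D: "norm D \<ge> x\<^sup>2 / 4"
    using norm_exp_symmetric_ge[OF assms(1)] by (simp add: D_def x_def)
  then have D0: "norm D > 0" using x by (meson less_le_trans divide_pos_pos zero_less_numeral zero_less_power)
  \<comment> \<open>Near the origin the two double poles cancel and the difference is bounded by 1.
    Otherwise \<open>x \<ge> 1 / 4\<close>, and each reciprocal separately is of order
    \<open>1 / x ^ 2\<close>.\<close>
  have "norm (1 / z\<^sup>2 - 1 / D) \<le> 20 * x powr (- 5 / 4)"
  proof (cases "norm z \<le> 1 / 2")
    case True
    have "norm z ^ 4 = (norm z)\<^sup>2 * (norm z)\<^sup>2" by (simp add: power2_eq_square numeral_eq_Suc)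
    also have "\<dots> \<le> (norm z)\<^sup>2 * (1 / 4)"
      using power_mono[OF True norm_ge_zero, of 2] by (intro mult_left_mono) (auto simp: power2_eq_square)
    finally have z4: "norm z ^ 4 \<le> (norm z)\<^sup>2 / 4" by simp
    have "norm (D - z\<^sup>2) \<le> 2 / 3 * norm z ^ 4"
      using norm_exp_symmetric_Taylor[OF True] by (simp add: D_def)
    moreover have "norm (z\<^sup>2) - norm (D - z\<^sup>2) \<le> norm D"
      using norm_triangle_ineq2[of "z\<^sup>2" "z\<^sup>2 - D"] by (simp add: norm_minus_commute)
    ultimately have Dl: "norm D \<ge> 5 / 6 * (norm z)\<^sup>2"
      using z4 by (simp add: norm_power)
    have "norm (1 / z\<^sup>2 - 1 / D) = norm (D - z\<^sup>2) / ((norm z)\<^sup>2 * norm D)"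
      using x D0 by (subst diff_frac_eq) (auto simp: norm_divide norm_mult norm_power)
    also have "\<dots> \<le> (2 / 3 * norm z ^ 4) / ((norm z)\<^sup>2 * (5 / 6 * (norm z)\<^sup>2))"
      using x Dl \<open>norm (D - z\<^sup>2) \<le> 2 / 3 * norm z ^ 4\<close>
      by (intro frac_le mult_mono mult_left_mono) auto
    also have "\<dots> \<le> 1"
      using x by (simp add: power2_eq_square numeral_eq_Suc)
    also have "1 \<le> x powr (- 5 / 4)"
      using powr_mono2'[of "- 5 / 4" x 1] x True by simp
    finally show ?thesis by (smt (verit) powr_ge_zero)
  next
    case False
    then have x4: "x \<ge> 1 / 4" using x by simp
    have "norm (1 / z\<^sup>2 - 1 / D) \<le> 1 / (norm z)\<^sup>2 + 1 / norm D"
      using norm_triangle_ineq4[of "1 / z\<^sup>2" "1 / D"] by (simp add: norm_divide norm_power)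
    also have "\<dots> \<le> 1 / x\<^sup>2 + 1 / (x\<^sup>2 / 4)"
      using x D D0 by (intro add_mono divide_left_mono power_mono mult_pos_pos) auto
    also have "\<dots> = 5 * (1 / x\<^sup>2)"
      by simp
    also have "1 / x\<^sup>2 = x powr (- 3 / 4) * x powr (- 5 / 4)"
      using x by (simp add: powr_minus_divide powr_numeral flip: powr_add)
    also have "5 * (x powr (- 3 / 4) * x powr (- 5 / 4)) = 5 * x powr (- 3 / 4) * x powr (- 5 / 4)"
      by simp
    also have "\<dots> \<le> 5 * 4 * x powr (- 5 / 4)"
    proof (intro mult_right_mono mult_left_mono)
      have "x powr (- 3 / 4) \<le> (1 / 4) powr (- 3 / 4)"
        using x4 by (intro powr_mono2') auto
      also have "\<dots> = 4 powr (3 / 4)"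
        by (simp add: powr_divide powr_minus field_simps)
      also have "\<dots> \<le> 4 powr 1"
        by (intro powr_mono) auto
      finally show "x powr (- 3 / 4) \<le> 4" by simp
    qed auto
    finally show ?thesis by simp
  qed
  then show ?thesis by (simp add: x_def D_def)
qed

text \<open>The full geometric series in \<open>exp (- z)\<close> with its pole at the origin
  removed, that is, the regular part of the Bernoulli generating function.\<close>

definition pole_free :: "complex \<Rightarrow> complex" where
  "pole_free z = 1 / (1 - exp (- z)) - 1 / z"

lemma pole_free_increment:
  assumes "x > 0" "\<bar>y\<bar> \<le> x"
  shows "norm (pole_free (Complex x y) - pole_free (of_real x)) \<le> 20 * x powr (- 5 / 4) * \<bar>y\<bar>"
proof -
  define S where "S = {z. Re z = x \<and> \<bar>Im z\<bar> \<le> x}"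
  \<comment> \<open>A rectangle of width zero: the vertical segment over \<open>x\<close>, inside
    the sector where the derivative bound holds.\<close>
  have "S = cbox (Complex x (- x)) (Complex x x)"
    by (auto simp: S_def in_cbox_complex_iff)
  then have conv: "convex S" by simp
  have deriv: "(pole_free has_field_derivative (1 / z\<^sup>2 - 1 / (exp z + exp (- z) - 2))) (at z within S)"
    if "z \<in> S" for z
  proof -
    have z: "z \<noteq> 0" "Re z > 0" using that assms by (auto simp: S_def)
    then have ne: "exp (- z) \<noteq> 1"
      using norm_exp_eq_Re[of "- z"] by (metis exp_eq_one_iff less_irrefl neg_less_0_iff_less norm_one uminus_complex.sel(1))
    have "exp z + exp (- z) - 2 = (1 - exp (- z))\<^sup>2 / exp (- z)"
      by (simp add: power2_eq_square field_simps exp_minus)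
    then have "1 / (exp z + exp (- z) - 2) = exp (- z) / (1 - exp (- z))\<^sup>2"
      by simp
    moreover have "(pole_free has_field_derivative (1 / z\<^sup>2 - exp (- z) / (1 - exp (- z))\<^sup>2)) (at z within S)"
      unfolding pole_free_def [abs_def] using z ne
      by (auto intro!: derivative_eq_intros simp: power2_eq_square)
    ultimately show ?thesis by simp
  qed
  have "norm (pole_free (Complex x y) - pole_free (of_real x)) \<le> 20 * x powr (- 5 / 4) * norm (Complex x y - of_real x)"
  proof (rule field_differentiable_bound[OF conv deriv])
    show "norm (1 / z\<^sup>2 - 1 / (exp z + exp (- z) - 2)) \<le> 20 * x powr (- 5 / 4)" if "z \<in> S" for z
      using norm_bernoulli_deriv_le[of z] that assms by (simp add: S_def)
  qed (use assms in \<open>auto simp: S_def\<close>)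
  moreover have "Complex x y - of_real x = \<i> * of_real y" by (simp add: complex_eq_iff)
  ultimately show ?thesis by (simp add: norm_mult)
qed

text \<open>The poles \<open>1 / w\<close> and \<open>1 / (k * w)\<close> of the two geometric
  series combine to the factor \<open>1 - 1 / k\<close>; what remains is regular at the
  origin.\<close>

lemma geo_diff_exp:
  assumes "Re w > 0" "k \<ge> 1"
  shows "geo_diff k (exp (- w)) = pole_free w - pole_free (of_nat k * w) + of_real (1 - 1 / k) * (1 / w)"
proof -
  have "exp (- w) ^ k = exp (- (of_nat k * w))"
    by (simp flip: exp_of_nat_mult)
  moreover have "of_real (1 - 1 / k) * (1 / w) = 1 / w - 1 / (of_nat k * w)"
  proof -
    have "w \<noteq> 0" using assms by auto
    then show ?thesis using assms by (simp add: field_simps)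
  qed
  ultimately show ?thesis
    by (simp only: geo_diff_def pole_free_def) simp
qed

text \<open>The coefficient \<kappa> of the singular part \<open>1 / s\<close> of
  \<open>log_gf k (exp (- s))\<close>: the poles in \<open>geo_diff_exp\<close> contribute
  \<open>1 - 1 / k\<close>, and summing the inverse squares of the exponents contributes
  \<pi>^2/6.\<close>

definition log_gf_leading :: "nat \<Rightarrow> real" where
  "log_gf_leading k = (1 - 1 / k) * (pi\<^sup>2 / 6)"

text \<open>Taking differences along the vertical line through \<open>a\<close> removes everything
  that depends on \<open>a\<close> alone. In the term with exponent \<open>L\<close> the pole-free
  parts move by at most a constant times
  \<open>L * \<bar>\<theta>\<bar> * (L * a) powr (- 5 / 4)\<close>; division by \<open>L\<close>
  leaves a convergent sum over \<open>L\<close>.\<close>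

lemma log_gf_increment:
  assumes k: "k \<ge> 1" and a: "a > 0" and \<theta>: "\<bar>\<theta>\<bar> \<le> a"
  shows "norm (log_gf k (exp (- Complex a (- \<theta>))) - log_gf k (exp (- of_real a))
      - of_real (log_gf_leading k) * (1 / Complex a (- \<theta>) - 1 / of_real a))
    \<le> (\<Sum>l. 20 * (1 + real k) * real (Suc l) powr (- 5 / 4)) * (\<bar>\<theta>\<bar> * a powr (- 5 / 4))"
proof -
  define s where "s = Complex a (- \<theta>)"
  define c where "c = complex_of_real (1 - 1 / k) * (1 / s - 1 / of_real a)"
  define u where "u = (\<lambda>l. geo_diff k (exp (- s) ^ Suc l) / of_nat (Suc l)
      - geo_diff k (exp (- of_real a) ^ Suc l) / of_nat (Suc l) - c * (1 / (of_nat l + 1)\<^sup>2))"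
  have s: "Re s = a" "s \<noteq> 0" using a by (auto simp: s_def complex_eq_iff)
  have "(\<lambda>l. complex_of_real (1 / (real l + 1)\<^sup>2)) sums of_real (pi\<^sup>2 / 6)"
    by (rule sums_of_real) (use inverse_squares_sums in \<open>simp add: add.commute\<close>)
  then have sq: "(\<lambda>l. 1 / (of_nat l + 1 :: complex)\<^sup>2) sums of_real (pi\<^sup>2 / 6)"
    by simp
  have "u sums (log_gf k (exp (- s)) - log_gf k (exp (- of_real a)) - c * of_real (pi\<^sup>2 / 6))"
    unfolding u_def using a s k
    by (intro sums_diff sums_mult sq log_gf_sums) (auto simp: norm_exp_eq_Re)
  also have "c * of_real (pi\<^sup>2 / 6) = of_real (log_gf_leading k) * (1 / s - 1 / of_real a)"
    by (simp add: c_def log_gf_leading_def)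
  finally have sums: "u sums (log_gf k (exp (- s)) - log_gf k (exp (- of_real a))
      - of_real (log_gf_leading k) * (1 / s - 1 / of_real a))" .
  \<comment> \<open>Applied with \<open>m = L\<close> and \<open>m = k * L\<close>; in both cases
    the decay is measured by \<open>L\<close>, so that the two bounds can be added.\<close>
  have inc: "norm (pole_free (of_nat m * s) - pole_free (of_nat m * of_real a)) \<le>
      20 * real m * (real l) powr (- 5 / 4) * (\<bar>\<theta>\<bar> * a powr (- 5 / 4))" if "l > 0" "m \<ge> l" for l m
  proof -
    have m: "m > 0" using that by simp
    have "of_nat m * s = Complex (real m * a) (- real m * \<theta>)" "of_nat m * complex_of_real a = of_real (real m * a)"
      by (auto simp: s_def complex_eq_iff)
    then have "norm (pole_free (of_nat m * s) - pole_free (of_nat m * of_real a)) \<le>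
        20 * (real m * a) powr (- 5 / 4) * \<bar>- real m * \<theta>\<bar>"
      using pole_free_increment[of "real m * a" "- real m * \<theta>"] a \<theta> m by (simp add: abs_mult)
    also have "\<dots> = 20 * real m * real m powr (- 5 / 4) * (\<bar>\<theta>\<bar> * a powr (- 5 / 4))"
      using a by (simp add: powr_mult abs_mult)
    also have "\<dots> \<le> 20 * real m * real l powr (- 5 / 4) * (\<bar>\<theta>\<bar> * a powr (- 5 / 4))"
      using that by (intro mult_right_mono mult_left_mono powr_mono2') auto
    finally show ?thesis .
  qed
  define E where "E = \<bar>\<theta>\<bar> * a powr (- 5 / 4)"
  have bound: "norm (u l) \<le> 20 * (1 + real k) * real (Suc l) powr (- 5 / 4) * E" for l
  proof -
    define L where "L = Suc l"
    have pow: "exp (- w) ^ L = exp (- (of_nat L * w))" for w :: complex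
      by (simp flip: exp_of_nat_mult)
    define d1 where "d1 = pole_free (of_nat L * s) - pole_free (of_nat L * of_real a)"
    define d2 where "d2 = pole_free (of_nat (k * L) * s) - pole_free (of_nat (k * L) * of_real a)"
    have "u l = (geo_diff k (exp (- (of_nat L * s))) - geo_diff k (exp (- (of_nat L * of_real a)))) / of_nat L
        - c * (1 / (of_nat L)\<^sup>2)"
      unfolding u_def L_def[symmetric] pow by (simp add: L_def diff_divide_distrib add.commute)
    also have "geo_diff k (exp (- (of_nat L * s))) - geo_diff k (exp (- (of_nat L * of_real a))) =
        d1 - d2 + of_real (1 - 1 / k) * (1 / (of_nat L * s) - 1 / (of_nat L * of_real a))"
      using s a k by (subst (1 2) geo_diff_exp) (auto simp: L_def d1_def d2_def algebra_simps intro!: add_pos_nonneg)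
    also have "1 / (of_nat L * s) - 1 / (of_nat L * of_real a) = (1 / s - 1 / of_real a) / of_nat L"
      by (simp add: diff_divide_distrib mult.commute)
    finally have "u l = (d1 - d2) / of_nat L"
      by (simp add: c_def add_divide_distrib power2_eq_square)
    then have "norm (u l) = norm (d1 - d2) / L" by (simp add: norm_divide)
    also have "\<dots> \<le> (norm d1 + norm d2) / L"
      by (intro divide_right_mono norm_triangle_ineq4) auto
    also have "\<dots> \<le> (20 * real L * (real L) powr (- 5 / 4) * E + 20 * real (k * L) * (real L) powr (- 5 / 4) * E) / L"
      unfolding E_def d1_def d2_def using k by (intro divide_right_mono add_mono inc) (simp_all add: L_def del: mult_Suc_right)
    also have "\<dots> = 20 * (1 + real k) * real L powr (- 5 / 4) * E"
      by (simp add: L_def field_simps)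
    finally show ?thesis by (simp add: L_def)
  qed
  have summ: "summable (\<lambda>l. 20 * (1 + real k) * real (Suc l) powr (- 5 / 4))"
    using summable_real_powr_iff[of "- 5 / 4"]
    by (intro summable_mult, subst summable_Suc_iff) simp
  have "norm (suminf u) \<le> (\<Sum>l. 20 * (1 + real k) * real (Suc l) powr (- 5 / 4) * E)"
    by (intro norm_suminf_le bound summable_mult2 summ)
  also have "\<dots> = (\<Sum>l. 20 * (1 + real k) * real (Suc l) powr (- 5 / 4)) * E"
    using suminf_mult2[OF summ, of E] by simp
  finally show ?thesis
    using sums_unique[OF sums] unfolding s_def E_def by simp
qed

section \<open>Decay away from the positive axis\<close>

text \<open>Jordan's inequality: a concave function lies above its chord.\<close>

lemma sin_ge_linear:
  assumes "0 \<le> x" "x \<le> pi / 2"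
  shows "sin x \<ge> 2 * x / pi"
proof -
  have "concave_on {0..pi / 2} sin"
  proof (rule f''_le0_imp_concave)
    show "(sin has_real_derivative cos x) (at x)" for x by (rule DERIV_sin)
    show "(cos has_real_derivative - sin x) (at x)" for x by (rule DERIV_cos)
    show "- sin x \<le> 0" if "x \<in> {0..pi / 2}" for x
      using that by (auto intro!: sin_ge_zero)
  qed auto
  from concave_onD_Icc'[OF this, of x] show ?thesis
    using assms by simp
qed

lemma one_minus_cos_ge:
  assumes "\<bar>x\<bar> \<le> pi"
  shows "1 - cos x \<ge> 2 * x\<^sup>2 / pi\<^sup>2"
proof -
  have "(2 * \<bar>x / 2\<bar> / pi)\<^sup>2 \<le> (sin \<bar>x / 2\<bar>)\<^sup>2"
    using assms sin_ge_linear[of "\<bar>x / 2\<bar>"] by (intro power_mono) auto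
  also have "\<dots> = (sin (x / 2))\<^sup>2"
    by (cases "x \<ge> 0") (auto simp: abs_if)
  finally show ?thesis
    using cos_double_sin[of "x / 2"] by (simp add: power_divide)
qed

text \<open>
  Only the first term of the series for the logarithm is needed to bound the generating function off
  the positive axis; the remaining terms have the right sign.
\<close>

definition minor_gap :: "nat \<Rightarrow> complex \<Rightarrow> real" where
  "minor_gap k z = Re (geo_diff k (of_real (norm z))) - Re (geo_diff k z)"

lemma norm_exp_log_gf_le:
  assumes "k \<ge> 1" "norm z < 1"
  shows "norm (exp (log_gf k z)) \<le> exp (Re (log_gf k (of_real (norm z))) - minor_gap k z)"
proof -
  define u where "u = (\<lambda>l. Re (geo_diff k (of_real (norm z) ^ Suc l) / of_nat (Suc l))
      - Re (geo_diff k (z ^ Suc l) / of_nat (Suc l)))"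
  have "u sums (Re (log_gf k (of_real (norm z))) - Re (log_gf k z))"
    unfolding u_def using assms by (intro sums_diff sums_Re log_gf_sums) auto
  moreover have "u l \<ge> 0" for l
  proof -
    have "Re (geo_diff k (z ^ Suc l)) \<le> Re (geo_diff k (of_real (norm z) ^ Suc l))"
      using norm_geo_diff_le_Re[of k "z ^ Suc l"] complex_Re_le_cmod[of "geo_diff k (z ^ Suc l)"]
        norm_power_less_1[of z "Suc l"] assms
      by (simp add: norm_power del: power_Suc)
    then show ?thesis
      by (simp add: u_def divide_right_mono del: power_Suc of_nat_Suc flip: diff_divide_distrib)
  qed
  ultimately have "u 0 \<le> Re (log_gf k (of_real (norm z))) - Re (log_gf k z)"
    using sum_le_suminf[of u "{0}"] by (simp add: sums_iff)
  then show ?thesis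
    by (simp add: u_def minor_gap_def)
qed

text \<open>The gap is the sum of \<open>r ^ m * (1 - cos (m * \<theta>))\<close> over all
  \<open>m\<close> not divisible by \<open>k\<close>. The terms are nonnegative, so any finite
  selection of them bounds it from below.\<close>

lemma minor_gap_ge_sum:
  assumes k: "k \<ge> 1" and r: "0 \<le> r" "r < 1" and A: "finite A" "\<And>m. m \<in> A \<Longrightarrow> \<not> k dvd m"
  shows "minor_gap k (of_real r * cis \<theta>) \<ge> (\<Sum>m\<in>A. r ^ m * (1 - cos (m * \<theta>)))"
proof -
  define z where "z = of_real r * cis \<theta>"
  have z: "norm z = r" using r by (simp add: z_def norm_mult)
  define t where "t = (\<lambda>N. Re (\<Sum>m\<in>truncated_parts k N. of_real r ^ m) - Re (\<Sum>m\<in>truncated_parts k N. z ^ m))"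
  have lim: "t \<longlonglongrightarrow> minor_gap k z"
    unfolding t_def minor_gap_def z using k r z
    by (intro tendsto_diff tendsto_Re tendsto_sum_truncated_parts) auto
  have t: "t N = (\<Sum>m\<in>truncated_parts k N. r ^ m * (1 - cos (m * \<theta>)))" for N
    by (simp add: t_def z_def power_mult_distrib Complex.DeMoivre right_diff_distrib sum_subtractf flip: of_real_power)
  obtain N0 where N0: "\<And>m. m \<in> A \<Longrightarrow> m < N0"
    using A(1) by (metis finite_nat_set_iff_bounded)
  have "(\<Sum>m\<in>A. r ^ m * (1 - cos (m * \<theta>))) \<le> t N" if "N \<ge> N0" for N
    unfolding t
  proof (rule sum_mono2)
    show "finite (truncated_parts k N)" by (simp add: truncated_parts_def)
    show "A \<subseteq> truncated_parts k N"
    proof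
      fix m assume m: "m \<in> A"
      have "m < N" using N0[OF m] that by simp
      also have "N \<le> k * N" using k by simp
      finally show "m \<in> truncated_parts k N" using m A k by (simp add: truncated_parts_iff)
    qed
  qed (use r in auto)
  then show ?thesis
    using LIMSEQ_le_const[OF lim] unfolding z_def by blast
qed

lemma sum_squares_ge_cube: "real J ^ 3 / 3 \<le> (\<Sum>j=1..J. (real j)\<^sup>2)"
  by (induction J) (auto simp: power2_eq_square power3_eq_cube field_simps)

text \<open>Select about \<open>1 / (8 * k^2 * a)\<close> values of \<open>m\<close>, so few that
  \<open>m * a \<le> 1 / (4 * k)\<close>. Then \<open>r ^ m \<ge> 1 / 2\<close> and
  \<open>\<bar>m * \<theta>\<bar> \<le> pi\<close>, each term is at least of order
  \<open>m^2 * \<theta>^2\<close>, and the sum of squares over roughly \<open>1 / a\<close> values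
  yields \<open>\<theta>^2 / a^3\<close>.\<close>

lemma minor_gap_near:
  assumes k: "k \<ge> 2" and a: "a > 0" "8 * (real k)\<^sup>2 * a \<le> 1" and \<theta>: "\<bar>\<theta>\<bar> \<le> 4 * pi * k * a"
  shows "minor_gap k (of_real (exp (- a)) * cis \<theta>) \<ge> 1 / (3 * pi\<^sup>2 * (16 * (real k)\<^sup>2) ^ 3) * (\<theta>\<^sup>2 / a ^ 3)"
proof -
  define r where "r = exp (- a)"
  define J where "J = nat \<lfloor>1 / (8 * (real k)\<^sup>2 * a)\<rfloor>"
  define y where "y = 1 / (8 * (real k)\<^sup>2 * a)"
  have y1: "y \<ge> 1" using a k by (simp add: y_def)
  have Jy: "real J \<le> y" "y < real J + 1"
    using y1 unfolding J_def y_def[symmetric] by linarith+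
  then have J1: "real J \<ge> 1"
    using y1 unfolding J_def y_def[symmetric] by (simp add: le_nat_iff nat_le_real_less)
  then have J: "real J \<ge> y / 2" using Jy by linarith
  \<comment> \<open>The residue class 1 modulo \<open>k\<close>, which avoids multiples of
    \<open>k\<close> because \<open>k \<ge> 2\<close>.\<close>
  define A where "A = (\<lambda>j. k * j + 1) ` {1..J}"
  have inj: "inj_on (\<lambda>j. k * j + 1) {1..J}" using k by (auto simp: inj_on_def)
  have ndvd: "\<not> k dvd k * j + 1" for j
    using k by (metis dvd_add_right_iff dvd_triv_left nat_dvd_1_iff_1 numeral_le_one_iff semiring_norm(69))
  have term_ge: "\<theta>\<^sup>2 / pi\<^sup>2 * (real j)\<^sup>2 \<le> r ^ (k * j + 1) * (1 - cos (real (k * j + 1) * \<theta>))"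
    if j: "j \<in> {1..J}" for j
  proof -
    define m where "m = k * j + 1"
    have "real m \<le> 2 * k * real j"
    proof -
      have "1 \<le> k * j" using j k by simp
      then have "m \<le> 2 * k * j" by (simp add: m_def)
      then show ?thesis by (metis of_nat_le_iff of_nat_mult of_nat_numeral)
    qed
    also have "\<dots> \<le> 2 * k * y"
      using j Jy(1) by (intro mult_left_mono) auto
    also have "\<dots> = 1 / (4 * k * a)"
      using k a by (simp add: y_def power2_eq_square field_simps)
    finally have m: "real m * a \<le> 1 / (4 * k)"
      using k a by (simp add: field_simps)
    have "r ^ m = exp (- (real m * a))"
      by (simp add: r_def flip: exp_of_nat_mult)
    also have "\<dots> \<ge> 1 - real m * a"
      using exp_ge_add_one_self[of "- (real m * a)"] by simp
    finally have "r ^ m \<ge> 1 - real m * a" .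
    moreover have "1 / (4 * real k) \<le> 1 / 2" using k by (simp add: field_simps)
    ultimately have rm: "r ^ m \<ge> 1 / 2" using m by linarith
    have "\<bar>real m * \<theta>\<bar> \<le> real m * (4 * pi * k * a)"
      using \<theta> by (simp add: abs_mult mult_left_mono)
    also have "\<dots> = (real m * a) * (4 * k) * pi" by simp
    also have "\<dots> \<le> 1 * pi"
      using m k by (intro mult_right_mono) (auto simp: field_simps)
    finally have "1 - cos (real m * \<theta>) \<ge> 2 * (real m * \<theta>)\<^sup>2 / pi\<^sup>2"
      by (intro one_minus_cos_ge) simp
    then have "r ^ m * (1 - cos (real m * \<theta>)) \<ge> 1 / 2 * (2 * (real m * \<theta>)\<^sup>2 / pi\<^sup>2)"
      using rm by (intro mult_mono) auto
    moreover have "(real j)\<^sup>2 \<le> (real m)\<^sup>2"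
    proof -
      have "1 * j \<le> k * j" using k by (intro mult_right_mono) auto
      then have "j \<le> m" unfolding m_def by linarith
      then show ?thesis by (intro power_mono) auto
    qed
    then have "\<theta>\<^sup>2 / pi\<^sup>2 * (real j)\<^sup>2 \<le> \<theta>\<^sup>2 / pi\<^sup>2 * (real m)\<^sup>2"
      by (intro mult_left_mono) auto
    ultimately show ?thesis
      unfolding m_def[symmetric] by (simp add: power_mult_distrib mult.commute)
  qed
  have "1 / (3 * pi\<^sup>2 * (16 * (real k)\<^sup>2) ^ 3) * (\<theta>\<^sup>2 / a ^ 3) = \<theta>\<^sup>2 / pi\<^sup>2 * ((y / 2) ^ 3 / 3)"
    using a k by (simp add: y_def field_simps)
  also have "\<dots> \<le> \<theta>\<^sup>2 / pi\<^sup>2 * (real J ^ 3 / 3)"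
    using J y1 by (intro mult_left_mono divide_right_mono power_mono) auto
  also have "\<dots> \<le> \<theta>\<^sup>2 / pi\<^sup>2 * (\<Sum>j=1..J. (real j)\<^sup>2)"
    by (intro mult_left_mono sum_squares_ge_cube) auto
  also have "\<dots> \<le> (\<Sum>j=1..J. r ^ (k * j + 1) * (1 - cos (real (k * j + 1) * \<theta>)))"
    unfolding sum_distrib_left by (intro sum_mono term_ge)
  also have "\<dots> = (\<Sum>m\<in>A. r ^ m * (1 - cos (real m * \<theta>)))"
    unfolding A_def by (subst sum.reindex[OF inj]) (simp add: o_def)
  also have "\<dots> \<le> minor_gap k (of_real r * cis \<theta>)"
    using k a ndvd by (intro minor_gap_ge_sum) (auto simp: A_def r_def)
  finally show ?thesis by (simp add: r_def)
qed

text \<open>On the positive axis the series is at least \<open>1 / (2 * k * a)\<close>. The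
  threshold \<open>4 * pi * k * a\<close> is where
  \<open>norm (1 - q) \<ge> \<bar>\<theta>\<bar> / pi\<close> guarantees that
  \<open>1 / norm (1 - q)\<close> is at most half of that.\<close>

lemma minor_gap_far:
  assumes k: "k \<ge> 2" and a: "a > 0" "a \<le> 1 / 2" and \<theta>: "\<bar>\<theta>\<bar> \<ge> 4 * pi * k * a" "\<bar>\<theta>\<bar> \<le> pi"
  shows "minor_gap k (of_real (exp (- a)) * cis \<theta>) \<ge> 1 / (4 * k) * (1 / a)"
proof -
  define r where "r = exp (- a)"
  define q where "q = of_real r * cis \<theta>"
  have r: "r \<ge> 1 / 2" "r < 1" using exp_ge_add_one_self[of "- a"] a by (auto simp: r_def)
  have q: "norm q = r" using r by (simp add: q_def norm_mult)
  have rk: "0 < 1 - r ^ k" using r k by (simp add: power_less_one_iff)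
  have "r ^ k = exp (- (real k * a))"
    by (simp add: r_def flip: exp_of_nat_mult)
  also have "\<dots> \<ge> 1 - real k * a"
    using exp_ge_add_one_self[of "- (real k * a)"] by simp
  finally have rk': "1 - r ^ k \<le> k * a" by simp
  have "1 / 2 / (k * a) \<le> r / (1 - r ^ k)"
    using r rk rk' by (intro frac_le) auto
  also have "\<dots> = ((1 - r) * r) / ((1 - r) * (1 - r ^ k))"
    using r by simp
  also have "(1 - r) * r = r - r * r"
    by (simp add: algebra_simps)
  also have "(r - r * r) / ((1 - r) * (1 - r ^ k)) \<le> (r - r ^ k) / ((1 - r) * (1 - r ^ k))"
    using r rk power_decreasing[of 2 k r] k
    by (intro divide_right_mono) (auto simp: power2_eq_square)
  also have "\<dots> = 1 / (1 - r) - 1 / (1 - r ^ k)"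
    using r rk by (subst diff_frac_eq) (auto simp: algebra_simps)
  finally have major: "Re (geo_diff k (of_real r)) \<ge> 1 / 2 / (k * a)"
    by (simp add: geo_diff_of_real)
  have "(norm (1 - q))\<^sup>2 = (1 - r * cos \<theta>)\<^sup>2 + (r * sin \<theta>)\<^sup>2"
    by (simp add: cmod_power2 q_def)
  also have "\<dots> = (1 - r)\<^sup>2 + 2 * r * (1 - cos \<theta>)"
    unfolding power_mult_distrib sin_squared_eq by (simp add: power2_eq_square algebra_simps)
  also have "\<dots> \<ge> 0 + 2 * (1 / 2) * (2 * \<theta>\<^sup>2 / pi\<^sup>2)"
    using r one_minus_cos_ge[OF \<theta>(2)] by (intro add_mono mult_mono) auto
  finally have "2 * (\<theta>\<^sup>2 / pi\<^sup>2) \<le> (norm (1 - q))\<^sup>2" by simp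
  moreover have "0 \<le> \<theta>\<^sup>2 / pi\<^sup>2" by simp
  ultimately have "\<theta>\<^sup>2 / pi\<^sup>2 \<le> (norm (1 - q))\<^sup>2" by linarith
  then have "(norm (1 - q))\<^sup>2 \<ge> (\<bar>\<theta>\<bar> / pi)\<^sup>2"
    by (simp add: power_divide)
  then have "norm (1 - q) \<ge> \<bar>\<theta>\<bar> / pi"
    by (rule power2_le_imp_le) simp
  moreover have "\<bar>\<theta>\<bar> / pi \<ge> 4 * real k * a"
    using \<theta>(1) by (simp add: field_simps)
  ultimately have "norm (1 - q) \<ge> 4 * real k * a" by linarith
  moreover have "4 * real k * a > 0" using k a by simp
  ultimately have "1 / norm (1 - q) \<le> 1 / (4 * real k * a)"
    by (metis frac_le order_refl zero_le_one)
  moreover have "Re (1 / (1 - q)) \<le> 1 / norm (1 - q)"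
    using complex_Re_le_cmod[of "1 / (1 - q)"] by (simp add: norm_divide)
  \<comment> \<open>The second geometric series enters \<open>geo_diff\<close> with a minus sign, so
    a nonnegative real part suffices even where \<open>q ^ k\<close> is close to 1.\<close>
  moreover have "Re (1 / (1 - q ^ k)) \<ge> 0"
  proof -
    have "norm (q ^ k) < 1" using q r k by (intro norm_power_less_1) auto
    then have "Re (1 - q ^ k) \<ge> 0"
      using complex_Re_le_cmod[of "q ^ k"] by simp
    then show ?thesis by (simp add: Re_divide)
  qed
  ultimately have "Re (geo_diff k q) \<le> 1 / (4 * real k * a)"
    by (simp add: geo_diff_def)
  with major have "1 / 2 / (k * a) - 1 / (4 * real k * a) \<le> minor_gap k q"
    unfolding minor_gap_def q by (rule diff_mono)
  moreover have "1 / 2 / (k * a) - 1 / (4 * real k * a) = 1 / (4 * real k) * (1 / a)"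
    by (simp add: field_simps)
  ultimately show ?thesis
    unfolding q_def r_def by (simp add: mult_ac)
qed

text \<open>Both regimes are expressed through u = \<theta>^2/a^3, because after
  \<open>\<theta> = \<delta> * t\<close> this is comparable to t^2 uniformly in n. In the far regime
  u is at most \<pi>^2/a^3, so a gap of order 1/a has a cube of order at least u; this explains the
  third power.\<close>

lemma minor_gap_cubed:
  assumes k: "k \<ge> 2"
  shows "\<exists>c>0. \<forall>a \<theta>. 0 < a \<longrightarrow> 8 * (real k)\<^sup>2 * a \<le> 1 \<longrightarrow> \<bar>\<theta>\<bar> \<le> pi \<longrightarrow>
    0 \<le> minor_gap k (of_real (exp (- a)) * cis \<theta>) \<and>
    c * min ((\<theta>\<^sup>2 / a ^ 3) ^ 3) (\<theta>\<^sup>2 / a ^ 3) \<le> minor_gap k (of_real (exp (- a)) * cis \<theta>) ^ 3"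
proof -
  define c1 c2 where "c1 = 1 / (3 * pi\<^sup>2 * (16 * (real k)\<^sup>2) ^ 3)" and "c2 = 1 / (4 * real k)"
  have c: "c1 > 0" "c2 > 0" using k by (auto simp: c1_def c2_def)
  have main: "0 \<le> minor_gap k (of_real (exp (- a)) * cis \<theta>) \<and>
      min (c1 ^ 3) (c2 ^ 3 / pi\<^sup>2) * min ((\<theta>\<^sup>2 / a ^ 3) ^ 3) (\<theta>\<^sup>2 / a ^ 3)
        \<le> minor_gap k (of_real (exp (- a)) * cis \<theta>) ^ 3"
    if a: "0 < a" "8 * (real k)\<^sup>2 * a \<le> 1" and \<theta>: "\<bar>\<theta>\<bar> \<le> pi" for a \<theta>
  proof -
    define G where "G = minor_gap k (of_real (exp (- a)) * cis \<theta>)"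
    define u where "u = \<theta>\<^sup>2 / a ^ 3"
    have u: "u \<ge> 0" using a by (simp add: u_def)
    have "0 \<le> G \<and> min (c1 ^ 3) (c2 ^ 3 / pi\<^sup>2) * min (u ^ 3) u \<le> G ^ 3"
    proof (cases "\<bar>\<theta>\<bar> \<le> 4 * pi * k * a")
      case True
      then have G: "c1 * u \<le> G"
        unfolding c1_def u_def G_def by (intro minor_gap_near k a)
      have cu: "0 \<le> c1 * u" using c u by simp
      have "min (c1 ^ 3) (c2 ^ 3 / pi\<^sup>2) * min (u ^ 3) u \<le> c1 ^ 3 * u ^ 3"
        using c u by (intro mult_mono) auto
      also have "\<dots> \<le> G ^ 3"
        using power_mono[OF G cu, of 3] by (simp add: power_mult_distrib)
      finally show ?thesis using G cu by linarith
    next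
      case False
      have "2 * 2 \<le> (real k)\<^sup>2"
        using k unfolding power2_eq_square by (intro mult_mono) auto
      then have "2 * a \<le> 8 * (real k)\<^sup>2 * a"
        using a by (intro mult_right_mono) auto
      then have "a \<le> 1 / 2" using a by linarith
      then have G: "c2 * (1 / a) \<le> G"
        using False \<theta> a k unfolding c2_def G_def by (intro minor_gap_far) auto
      have ca: "0 \<le> c2 * (1 / a)" using c a by simp
      have "\<theta>\<^sup>2 \<le> pi\<^sup>2"
        using power_mono[OF \<theta>, of 2] by simp
      have "min (c1 ^ 3) (c2 ^ 3 / pi\<^sup>2) * min (u ^ 3) u \<le> c2 ^ 3 / pi\<^sup>2 * u"
        using c u by (intro mult_mono) auto
      also have "\<dots> = c2 ^ 3 * (\<theta>\<^sup>2 / pi\<^sup>2) / a ^ 3"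
        by (simp add: u_def)
      also have "\<dots> \<le> c2 ^ 3 * 1 / a ^ 3"
        using \<open>\<theta>\<^sup>2 \<le> pi\<^sup>2\<close> c a by (intro divide_right_mono mult_left_mono) auto
      also have "\<dots> \<le> G ^ 3"
        using power_mono[OF G ca, of 3] by (simp add: power_mult_distrib power_divide)
      finally show ?thesis using G ca by linarith
    qed
    then show ?thesis by (simp only: G_def u_def)
  qed
  have "min (c1 ^ 3) (c2 ^ 3 / pi\<^sup>2) > 0" using c by simp
  with main show ?thesis by blast
qed

section \<open>Hermite polynomials as Gaussian means\<close>

text \<open>The moments of the centred normal distribution of variance 2, whose density is
  proportional to \<open>exp (- t^2 / 4)\<close>.\<close>

definition gauss_moment :: "nat \<Rightarrow> real" where
  "gauss_moment j = (if even j then fact j / fact (j div 2) else 0)"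

lemma gauss_moment_integral:
  "((\<lambda>t. exp (- t\<^sup>2 / 4) * t ^ j) has_integral sqrt (4 * pi) * gauss_moment j) UNIV"
proof -
  have eq: "exp (- t\<^sup>2 / 4) * t ^ j = sqrt (4 * pi) * (normal_density 0 (sqrt 2) t * (t - 0) ^ j)" for t :: real
    by (simp add: normal_density_def)
  have "has_bochner_integral lborel (\<lambda>t. normal_density 0 (sqrt 2) t * (t - 0) ^ j) (gauss_moment j)"
  proof (cases "even j")
    case True
    then obtain i where "j = 2 * i" by blast
    then show ?thesis
      using normal_moment_even[of "sqrt 2" 0 i] by (simp add: gauss_moment_def)
  next
    case False
    then obtain i where "j = 2 * i + 1" by (elim oddE)
    then show ?thesis
      using normal_moment_odd[of "sqrt 2" 0 i] by (simp add: gauss_moment_def)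
  qed
  then have "has_bochner_integral lborel (\<lambda>t. sqrt (4 * pi) * (normal_density 0 (sqrt 2) t * (t - 0) ^ j))
      (sqrt (4 * pi) * gauss_moment j)"
    by (rule has_bochner_integral_mult_right)
  then have *: "integrable lborel (\<lambda>t. sqrt (4 * pi) * (normal_density 0 (sqrt 2) t * (t - 0) ^ j))"
    "integral\<^sup>L lborel (\<lambda>t. sqrt (4 * pi) * (normal_density 0 (sqrt 2) t * (t - 0) ^ j)) = sqrt (4 * pi) * gauss_moment j"
    by (simp_all only: has_bochner_integral_iff)
  show ?thesis
    unfolding eq using has_integral_integral_lborel[OF *(1)] unfolding *(2) .
qed

lemma gauss_moment_Suc_Suc: "gauss_moment (Suc (Suc j)) = 2 * real (Suc j) * gauss_moment j"
proof (cases "even j")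
  case True
  then obtain i where i: "j = 2 * i" by blast
  have "fact (Suc (Suc (2 * i))) = (real i + 1) * (2 * (2 * real i + 1) * fact (2 * i))"
    by (simp add: algebra_simps)
  moreover have "fact (Suc i) = (real i + 1) * fact i"
    by simp
  ultimately have "fact (Suc (Suc (2 * i))) / fact (Suc i) = 2 * (2 * real i + 1) * fact (2 * i) / (fact i :: real)"
    by (simp only:) (rule mult_divide_mult_cancel_left, simp)
  then show ?thesis using i by (simp add: gauss_moment_def)
qed (simp add: gauss_moment_def)

text \<open>The mean of \<open>(\<i> * t) ^ j\<close> under this Gaussian, which is also the value
  of \<open>hermite j\<close> at 0. Odd moments vanish, so \<open>\<i> ^ j * gauss_moment j\<close>
  is real and \<open>Re\<close> loses nothing.\<close>

definition hermite_coeff :: "nat \<Rightarrow> real" where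
  "hermite_coeff j = Re (\<i> ^ j) * gauss_moment j"

lemma of_real_hermite_coeff: "of_real (hermite_coeff j) = \<i> ^ j * of_real (gauss_moment j)"
proof (cases "even j")
  case True
  then obtain i where "j = 2 * i" by blast
  then have "\<i> ^ j = of_real ((- 1) ^ i)" by (simp add: power_mult)
  then show ?thesis by (simp add: hermite_coeff_def)
qed (simp add: hermite_coeff_def gauss_moment_def)

lemma hermite_coeff_0: "hermite_coeff 0 = 1" and hermite_coeff_1: "hermite_coeff (Suc 0) = 0"
  by (simp_all add: hermite_coeff_def gauss_moment_def)

lemma hermite_coeff_Suc_Suc: "hermite_coeff (Suc (Suc j)) = - 2 * real (Suc j) * hermite_coeff j"
  by (simp add: hermite_coeff_def gauss_moment_Suc_Suc algebra_simps)

text \<open>The right-hand side is the Gaussian mean of \<open>(X + \<i> * t) ^ d\<close>. It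
  satisfies the recurrence \<open>hermite_rec\<close> with the same two initial values.\<close>

lemma hermite_eq_sum: "hermite d X = (\<Sum>j\<le>d. real (d choose j) * X ^ (d - j) * hermite_coeff j)"
proof -
  define P where "P = (\<lambda>d. \<Sum>j\<le>d. real (d choose j) * X ^ (d - j) * hermite_coeff j)"
  have rec: "P (Suc (Suc d)) = X * P (Suc d) - 2 * real (Suc d) * P d" for d
  proof -
    let ?n = "Suc d"
    have "P (Suc ?n) = X ^ Suc ?n + (\<Sum>j\<le>?n. real (Suc ?n choose Suc j) * X ^ (?n - j) * hermite_coeff (Suc j))"
      unfolding P_def by (subst sum.atMost_Suc_shift) (simp add: hermite_coeff_0)
    \<comment> \<open>Pascal's rule: one half reproduces \<open>X * P ?n\<close> up to its first
      term, the other yields the multiple of \<open>P d\<close>.\<close>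
    also have "(\<Sum>j\<le>?n. real (Suc ?n choose Suc j) * X ^ (?n - j) * hermite_coeff (Suc j)) =
        (\<Sum>j\<le>?n. real (?n choose j) * X ^ (?n - j) * hermite_coeff (Suc j)) +
        (\<Sum>j\<le>?n. real (?n choose Suc j) * X ^ (?n - j) * hermite_coeff (Suc j))"
      by (simp add: algebra_simps sum.distrib)
    also have "(\<Sum>j\<le>?n. real (?n choose Suc j) * X ^ (?n - j) * hermite_coeff (Suc j)) =
        (\<Sum>j\<le>d. real (?n choose Suc j) * X ^ (?n - j) * hermite_coeff (Suc j))"
      by (simp add: binomial_eq_0)
    also have "\<dots> = X * (\<Sum>j\<le>d. real (?n choose Suc j) * X ^ (d - j) * hermite_coeff (Suc j))"
      unfolding sum_distrib_left by (intro sum.cong) (auto simp: Suc_diff_le)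
    also have "\<dots> = X * P ?n - X ^ Suc ?n"
      unfolding P_def by (subst sum.atMost_Suc_shift) (simp add: hermite_coeff_0 algebra_simps)
    also have "(\<Sum>j\<le>?n. real (?n choose j) * X ^ (?n - j) * hermite_coeff (Suc j)) =
        (\<Sum>j\<le>d. real (?n choose Suc j) * X ^ (d - j) * hermite_coeff (Suc (Suc j)))"
      by (subst sum.atMost_Suc_shift) (simp add: hermite_coeff_1)
    \<comment> \<open>The factor \<open>Suc j\<close> from the recurrence of the moments is absorbed
      into the binomial coefficient.\<close>
    also have "\<dots> = (\<Sum>j\<le>d. - 2 * real ?n * (real (d choose j) * X ^ (d - j) * hermite_coeff j))"
    proof (intro sum.cong refl)
      fix j
      have "real (Suc j) * real (?n choose Suc j) = real ?n * real (d choose j)"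
        by (metis Suc_times_binomial_eq mult.commute of_nat_mult)
      then have "(- 2 * X ^ (d - j) * hermite_coeff j) * (real (Suc j) * real (?n choose Suc j)) =
          (- 2 * X ^ (d - j) * hermite_coeff j) * (real ?n * real (d choose j))"
        by (rule arg_cong)
      then show "real (?n choose Suc j) * X ^ (d - j) * hermite_coeff (Suc (Suc j)) =
          - 2 * real ?n * (real (d choose j) * X ^ (d - j) * hermite_coeff j)"
        unfolding hermite_coeff_Suc_Suc by (simp only: mult_ac)
    qed
    also have "\<dots> = - 2 * real ?n * P d"
      by (simp add: P_def sum_distrib_left)
    finally show ?thesis by (simp add: algebra_simps)
  qed
  have "hermite d X = P d \<and> hermite (Suc d) X = P (Suc d)"
  proof (induction d)
    case 0
    then show ?case
      using hermite_0 hermite_1 by (simp add: P_def hermite_coeff_0 hermite_coeff_1)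
  next
    case (Suc d)
    then show ?case by (simp only: rec hermite_rec)
  qed
  then show ?thesis by (simp add: P_def)
qed

section \<open>Elementary estimates for the limit of the integrals\<close>

lemma power_le_fact_exp:
  assumes "(y :: real) \<ge> 0"
  shows "y ^ N \<le> fact N * exp y"
proof -
  have sums: "(\<lambda>n. y ^ n /\<^sub>R fact n) sums exp y" by (rule exp_converges)
  have "(\<Sum>n\<in>{N}. y ^ n /\<^sub>R fact n) \<le> (\<Sum>n. y ^ n /\<^sub>R fact n)"
    using assms sums by (intro sum_le_suminf) (auto simp: sums_iff)
  then show ?thesis
    using sums by (simp add: sums_iff field_simps)
qed

lemma tendsto_one_minus_iexp:
  fixes \<delta> :: "nat \<Rightarrow> real"
  assumes "\<delta> \<longlonglongrightarrow> 0" "\<forall>\<^sub>F n in sequentially. \<delta> n > 0"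
  shows "(\<lambda>n. (1 - cis (- (\<delta> n * t))) / of_real (\<delta> n)) \<longlonglongrightarrow> \<i> * of_real t"
proof (rule Lim_null[THEN iffD2, OF Lim_null_comparison])
  show "\<forall>\<^sub>F n in sequentially. norm ((1 - cis (- (\<delta> n * t))) / of_real (\<delta> n) - \<i> * of_real t) \<le> t\<^sup>2 / 2 * \<delta> n"
    using assms(2)
  proof eventually_elim
    case (elim n)
    define x where "x = - (\<delta> n * t)"
    have "norm (cis x - (1 + \<i> * x)) \<le> x\<^sup>2 / 2"
      using iexp_approx1[of x 1] by (simp add: cis_conv_exp power2_eq_square)
    moreover have "(1 - cis x) / of_real (\<delta> n) - \<i> * of_real t = - (cis x - (1 + \<i> * x)) / of_real (\<delta> n)"
      using elim by (simp add: x_def field_simps)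
    ultimately have "norm ((1 - cis x) / of_real (\<delta> n) - \<i> * of_real t) \<le> x\<^sup>2 / 2 / \<delta> n"
      using elim by (simp only: norm_divide norm_minus_cancel norm_of_real divide_right_mono abs_of_pos less_imp_le)
    also have "\<dots> = t\<^sup>2 / 2 * \<delta> n"
      using elim by (simp add: x_def power2_eq_square)
    finally show ?case by (simp add: x_def)
  qed
  show "(\<lambda>n. t\<^sup>2 / 2 * \<delta> n) \<longlonglongrightarrow> 0"
    using assms(1) by (rule tendsto_mult_right_zero)
qed

lemma norm_one_minus_cis_le: "norm (1 - cis x) \<le> \<bar>x\<bar>"
  using iexp_approx1[of x 0] by (simp add: cis_conv_exp norm_minus_commute)

section \<open>The saddle point limit\<close>

text \<open>The exponent on the circle of radius \<open>exp (- a n)\<close> has a linear part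
  proportional to \<open>\<delta> n * (log_gf_leading k / (a n)^2 - n)\<close> and a quadratic part
  proportional to \<open>(\<delta> n)^2 / (a n)^3\<close>. So \<open>balance\<close> says that the
  radius is close enough to the saddle point, and \<open>width\<close> fixes the variance of the
  limiting Gaussian.\<close>

locale saddle =
  fixes k :: nat and a \<delta> :: "nat \<Rightarrow> real"
  assumes k: "k \<ge> 2"
    and a_pos: "\<forall>\<^sub>F n in sequentially. a n > 0"
    and \<delta>_pos: "\<forall>\<^sub>F n in sequentially. \<delta> n > 0"
    and a_tendsto: "a \<longlonglongrightarrow> 0"
    and width: "(\<lambda>n. (\<delta> n)\<^sup>2 / a n ^ 3) \<longlonglongrightarrow> 1 / (4 * log_gf_leading k)"
    and balance: "(\<lambda>n. \<delta> n * (log_gf_leading k / (a n)\<^sup>2 - n)) \<longlonglongrightarrow> 0"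
begin

lemma leading_pos: "log_gf_leading k > 0"
  using k by (simp add: log_gf_leading_def field_simps)

text \<open>Only the ratio of \<delta>^2 to a^3 is known to converge; smallness of a product with
  \<delta> is read off from its square.\<close>

lemma tendsto_sqrt_ratio:
  assumes "f \<longlonglongrightarrow> 0" and "\<forall>\<^sub>F n in sequentially. g n = sqrt ((\<delta> n)\<^sup>2 / a n ^ 3 * f n)"
  shows "g \<longlonglongrightarrow> 0"
proof -
  have "(\<lambda>n. sqrt ((\<delta> n)\<^sup>2 / a n ^ 3 * f n)) \<longlonglongrightarrow> sqrt (1 / (4 * log_gf_leading k) * 0)"
    by (intro tendsto_intros width assms)
  then show ?thesis
    using assms(2) by (simp add: filterlim_cong[OF refl refl assms(2)])
qed

text \<open>For fixed t this places \<open>\<theta> = \<delta> n * t\<close> eventually in the range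
  \<open>\<bar>\<theta>\<bar> \<le> a n\<close> where \<open>log_gf_increment\<close>
  applies.\<close>

lemma \<delta>_over_a: "(\<lambda>n. \<delta> n / a n) \<longlonglongrightarrow> 0"
proof (rule tendsto_sqrt_ratio[OF a_tendsto])
  show "\<forall>\<^sub>F n in sequentially. \<delta> n / a n = sqrt ((\<delta> n)\<^sup>2 / a n ^ 3 * a n)"
    using a_pos \<delta>_pos
  proof eventually_elim
    case (elim n)
    have "(\<delta> n)\<^sup>2 / a n ^ 3 * a n = (\<delta> n / a n)\<^sup>2"
      using elim by (simp add: power_divide power2_eq_square power3_eq_cube)
    then show ?case using elim by simp
  qed
qed

text \<open>This is the error of \<open>log_gf_increment\<close> at
  \<open>\<theta> = \<delta> n * t\<close>, up to a constant: \<delta> has order a^(3/2), which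
  leaves a^(1/4).\<close>

lemma \<delta>_times_powr: "(\<lambda>n. \<delta> n * a n powr (- 5 / 4)) \<longlonglongrightarrow> 0"
proof (rule tendsto_sqrt_ratio)
  show "(\<lambda>n. a n powr (1 / 2)) \<longlonglongrightarrow> 0"
    using tendsto_powr2[OF a_tendsto tendsto_const[of "1/2"]] a_pos
    by (simp add: eventually_mono)
  show "\<forall>\<^sub>F n in sequentially. \<delta> n * a n powr (- 5 / 4) = sqrt ((\<delta> n)\<^sup>2 / a n ^ 3 * a n powr (1 / 2))"
    using a_pos \<delta>_pos
  proof eventually_elim
    case (elim n)
    have "(a n powr (- 5 / 4))\<^sup>2 = a n powr (- 3 + 1 / 2)"
      using elim by (simp add: power2_eq_square flip: powr_add)
    also have "\<dots> = a n powr (1 / 2) / a n ^ 3"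
      using elim unfolding powr_add by (simp add: powr_minus_divide powr_numeral)
    finally have "(\<delta> n)\<^sup>2 / a n ^ 3 * a n powr (1 / 2) = (\<delta> n * a n powr (- 5 / 4))\<^sup>2"
      by (simp add: power_mult_distrib)
    then show ?case using elim by simp
  qed
qed

lemma \<delta>_tendsto: "\<delta> \<longlonglongrightarrow> 0"
proof -
  have "(\<lambda>n. \<delta> n / a n * a n) \<longlonglongrightarrow> 0 * 0"
    by (intro tendsto_mult \<delta>_over_a a_tendsto)
  moreover have "\<forall>\<^sub>F n in sequentially. \<delta> n / a n * a n = \<delta> n"
    using a_pos by eventually_elim simp
  ultimately show ?thesis by (simp add: filterlim_cong)
qed

definition weight :: "nat \<Rightarrow> real \<Rightarrow> complex" where
  "weight n \<theta> = exp (log_gf k (of_real (exp (- a n)) * cis \<theta>) - log_gf k (of_real (exp (- a n))))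
     * cis (- (n * \<theta>))"

lemma weight_tendsto: "(\<lambda>n. weight n (\<delta> n * t)) \<longlonglongrightarrow> of_real (exp (- t\<^sup>2 / 4))"
proof -
  define \<kappa> where "\<kappa> = log_gf_leading k"
  define s where "s = (\<lambda>n. Complex (a n) (- (\<delta> n * t)))"
  define Z where "Z = (\<Sum>l. 20 * (1 + real k) * real (Suc l) powr (- 5 / 4))"
  define e where "e = (\<lambda>n. log_gf k (exp (- s n)) - log_gf k (exp (- of_real (a n)))
      - of_real \<kappa> * (1 / s n - 1 / of_real (a n)))"
  have e: "e \<longlonglongrightarrow> 0"
  proof (rule Lim_null_comparison)
    have "(\<lambda>n. \<bar>\<delta> n / a n * t\<bar>) \<longlonglongrightarrow> \<bar>0 * t\<bar>"
      by (intro tendsto_intros \<delta>_over_a)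
    then have "\<forall>\<^sub>F n in sequentially. \<bar>\<delta> n / a n * t\<bar> < 1"
      by (rule order_tendstoD) simp
    then show "\<forall>\<^sub>F n in sequentially. norm (e n) \<le> Z * \<bar>t\<bar> * (\<delta> n * a n powr (- 5 / 4))"
      using a_pos \<delta>_pos
    proof eventually_elim
      case (elim n)
      then have "\<bar>\<delta> n * t\<bar> \<le> a n" by (simp add: abs_mult field_simps)
      with log_gf_increment[of k "a n" "\<delta> n * t"] k elim
      show ?case by (simp add: e_def s_def \<kappa>_def Z_def abs_mult mult_ac)
    qed
    show "(\<lambda>n. Z * \<bar>t\<bar> * (\<delta> n * a n powr (- 5 / 4))) \<longlonglongrightarrow> 0"
      by (intro tendsto_mult_right_zero \<delta>_times_powr)
  qed
  define x where "x = (\<lambda>n. complex_of_real (\<delta> n / a n))"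
  have x: "x \<longlonglongrightarrow> 0"
    unfolding x_def by (rule tendsto_of_real[OF \<delta>_over_a, simplified])
  \<comment> \<open>The exponent of \<open>weight n (\<delta> n * t)\<close>, arranged so that each
    summand is governed by one limit: the error \<open>e\<close>, \<open>balance\<close>, and
    \<open>width\<close> together with \<open>x\<close>.\<close>
  define E where "E = (\<lambda>n. e n + \<i> * of_real t * of_real (\<delta> n * (\<kappa> / (a n)\<^sup>2 - n))
     - of_real (t\<^sup>2 * \<kappa>) * of_real ((\<delta> n)\<^sup>2 / a n ^ 3) / (1 - \<i> * t * x n))"
  have "E \<longlonglongrightarrow> 0 + \<i> * of_real t * of_real 0 - of_real (t\<^sup>2 * \<kappa>) * of_real (1 / (4 * \<kappa>)) / (1 - \<i> * t * 0)"
    unfolding E_def \<kappa>_def by (intro tendsto_intros e x balance width) simp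
  also have "0 + \<i> * of_real t * of_real 0 - of_real (t\<^sup>2 * \<kappa>) * of_real (1 / (4 * \<kappa>)) / (1 - \<i> * t * 0) =
      complex_of_real (- t\<^sup>2 / 4)"
    using leading_pos by (simp add: \<kappa>_def)
  finally have "(\<lambda>n. exp (E n)) \<longlonglongrightarrow> exp (complex_of_real (- t\<^sup>2 / 4))"
    by (rule tendsto_exp)
  moreover have "\<forall>\<^sub>F n in sequentially. exp (E n) = weight n (\<delta> n * t)"
    using a_pos
  proof eventually_elim
    case (elim n)
    define A D where "A = complex_of_real (a n)" and "D = complex_of_real (\<delta> n * t)"
    have A: "A \<noteq> 0" "s n = A - \<i> * D" and s: "s n \<noteq> 0"
      using elim by (auto simp: A_def D_def s_def complex_eq_iff)
    have q: "exp (- s n) = of_real (exp (- a n)) * cis (\<delta> n * t)"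
      by (simp add: s_def exp_eq_polar)
    have "\<kappa> * (1 / s n - 1 / A) - \<i> * n * D = \<i> * D * (\<kappa> / A\<^sup>2 - n) - \<kappa> * D\<^sup>2 / (A\<^sup>2 * s n)"
    proof -
      \<comment> \<open>Expansion of the reciprocal at \<open>A\<close> with an exact remainder: the
        linear term combines with \<open>- \<i> * n * D\<close>, and the remainder is the Gaussian
        term.\<close>
      have eq: "1 / s n - 1 / A = \<i> * D / A\<^sup>2 - D\<^sup>2 / (A\<^sup>2 * s n)"
        using A s by (simp add: divide_simps) (simp add: power2_eq_square algebra_simps)
      show ?thesis unfolding eq by (simp add: algebra_simps)
    qed
    also have "A\<^sup>2 * s n = A ^ 3 * (1 - \<i> * t * x n)"
      using elim by (simp add: A x_def A_def D_def power2_eq_square power3_eq_cube field_simps)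
    finally have "E n = e n + (\<kappa> * (1 / s n - 1 / A) - \<i> * n * D)"
      by (simp add: E_def A_def D_def power_mult_distrib mult_ac)
    then have "E n = (log_gf k (exp (- s n)) - log_gf k (exp (- A))) + - (\<i> * n * D)"
      by (simp add: e_def A_def)
    then have "exp (E n) = exp (log_gf k (exp (- s n)) - log_gf k (exp (- A))) * exp (- (\<i> * n * D))"
      by (simp only: exp_add)
    moreover have "exp (- A) = of_real (exp (- a n))"
      by (simp add: A_def flip: exp_of_real)
    ultimately show ?case
      unfolding weight_def q by (simp add: D_def cis_conv_exp mult_ac)
  qed
  ultimately show ?thesis
    unfolding exp_of_real by (rule Lim_transform_eventually)
qed

lemma norm_weight_le:
  assumes "a n > 0"
  shows "norm (weight n \<theta>) \<le> exp (- minor_gap k (of_real (exp (- a n)) * cis \<theta>))"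
proof -
  define r z where "r = exp (- a n)" and "z = of_real r * cis \<theta>"
  have z: "norm z = r" "r < 1" using assms by (auto simp: z_def r_def norm_mult)
  have "norm (weight n \<theta>) = norm (exp (log_gf k z)) / norm (exp (log_gf k (of_real r)))"
    by (simp add: weight_def z_def r_def norm_mult exp_diff norm_divide)
  also have "\<dots> \<le> exp (Re (log_gf k (of_real r)) - minor_gap k z) / norm (exp (log_gf k (of_real r)))"
    using norm_exp_log_gf_le[of k z] k z by (intro divide_right_mono) auto
  also have "\<dots> = exp (- minor_gap k z)"
    by (simp add: exp_diff exp_minus field_simps)
  finally show ?thesis by (simp add: z_def r_def)
qed

text \<open>The weight is at most \<open>exp (- G)\<close> with \<open>G ^ 3\<close> at least a
  constant times \<open>t^2\<close> for \<open>\<bar>t\<bar> \<ge> 1\<close>. Any power of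
  \<open>t\<close> is thus bounded by a power of \<open>G\<close>, which the exponential
  absorbs.\<close>

lemma weight_dominated:
  "\<exists>C. \<forall>\<^sub>F n in sequentially. \<forall>t. \<bar>\<delta> n * t\<bar> \<le> pi \<longrightarrow> norm (weight n (\<delta> n * t)) * \<bar>t\<bar> ^ p \<le> C * inverse (1 + t\<^sup>2)"
proof -
  \<comment> \<open>Half the limit in \<open>width\<close>, so that eventually
    \<open>u \<ge> v * t^2\<close>.\<close>
  define v where "v = 1 / (8 * log_gf_leading k)"
  have v: "v > 0" "v < 1 / (4 * log_gf_leading k)" using leading_pos by (auto simp: v_def field_simps)
  obtain c where c: "c > 0" and gap: "\<And>a \<theta>. 0 < a \<Longrightarrow> 8 * (real k)\<^sup>2 * a \<le> 1 \<Longrightarrow> \<bar>\<theta>\<bar> \<le> pi \<Longrightarrow>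
    0 \<le> minor_gap k (of_real (exp (- a)) * cis \<theta>) \<and>
    c * min ((\<theta>\<^sup>2 / a ^ 3) ^ 3) (\<theta>\<^sup>2 / a ^ 3) \<le> minor_gap k (of_real (exp (- a)) * cis \<theta>) ^ 3"
    using minor_gap_cubed[OF k] by blast
  define c' where "c' = c * min (v ^ 3) v"
  have c': "c' > 0" using c v by (simp add: c'_def)
  define C where "C = max 2 (2 * (fact (3 * (p + 2)) / c' ^ (p + 2)))"
  have "(\<lambda>n. 8 * (real k)\<^sup>2 * a n) \<longlonglongrightarrow> 8 * (real k)\<^sup>2 * 0"
    by (intro tendsto_intros a_tendsto)
  then have "\<forall>\<^sub>F n in sequentially. 8 * (real k)\<^sup>2 * a n < 1"
    by (rule order_tendstoD) simp
  moreover have "\<forall>\<^sub>F n in sequentially. v < (\<delta> n)\<^sup>2 / a n ^ 3"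
    using width v(2) by (rule order_tendstoD)
  ultimately have "\<forall>\<^sub>F n in sequentially. \<forall>t. \<bar>\<delta> n * t\<bar> \<le> pi \<longrightarrow>
      norm (weight n (\<delta> n * t)) * \<bar>t\<bar> ^ p \<le> C * inverse (1 + t\<^sup>2)"
    using a_pos
  proof eventually_elim
    case (elim n)
    show ?case
    proof (intro allI impI)
      fix t assume t: "\<bar>\<delta> n * t\<bar> \<le> pi"
      define G where "G = minor_gap k (of_real (exp (- a n)) * cis (\<delta> n * t))"
      define u where "u = (\<delta> n * t)\<^sup>2 / a n ^ 3"
      have G: "0 \<le> G" "c * min (u ^ 3) u \<le> G ^ 3"
        using gap[of "a n" "\<delta> n * t"] elim t by (auto simp: G_def u_def)
      have w: "norm (weight n (\<delta> n * t)) \<le> exp (- G)"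
        unfolding G_def using elim by (intro norm_weight_le) auto
      have "norm (weight n (\<delta> n * t)) * \<bar>t\<bar> ^ p * (1 + t\<^sup>2) \<le> C"
      proof (cases "\<bar>t\<bar> \<le> 1")
        case True
        have "norm (weight n (\<delta> n * t)) * \<bar>t\<bar> ^ p * (1 + t\<^sup>2) \<le> 1 * 1 * 2"
        proof (intro mult_mono)
          show "norm (weight n (\<delta> n * t)) \<le> 1" using w G by (meson exp_le_one_iff neg_le_0_iff_le order_trans)
          show "\<bar>t\<bar> ^ p \<le> 1" using True by (simp add: power_le_one)
          show "1 + t\<^sup>2 \<le> 2" using True by (simp add: abs_square_le_1)
        qed auto
        then show ?thesis by (simp add: C_def)
      next
        case False
        then have t1: "t\<^sup>2 \<ge> 1" using one_le_power[of "\<bar>t\<bar>" 2] by simp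
        have u: "v * t\<^sup>2 \<le> u"
          using elim mult_right_mono[of v "(\<delta> n)\<^sup>2 / a n ^ 3" "t\<^sup>2"] by (simp add: u_def power_mult_distrib)
        \<comment> \<open>For \<open>t^2 \<ge> 1\<close> the minimum of the cube and the first power
          of \<open>v * t^2\<close> still grows at least linearly in \<open>t^2\<close>.\<close>
        have "c' * t\<^sup>2 \<le> c * min (u ^ 3) u"
        proof -
          have "min (v ^ 3) v * t\<^sup>2 \<le> v ^ 3 * (t\<^sup>2) ^ 3"
            using v t1 power_increasing[of 1 3 "t\<^sup>2"] by (intro mult_mono) auto
          also have "\<dots> = (v * t\<^sup>2) ^ 3" by (simp add: power_mult_distrib)
          also have "\<dots> \<le> u ^ 3" using u v by (intro power_mono) auto
          finally have 1: "min (v ^ 3) v * t\<^sup>2 \<le> u ^ 3" .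
          have "min (v ^ 3) v * t\<^sup>2 \<le> v * t\<^sup>2" by (intro mult_right_mono) auto
          then have "min (v ^ 3) v * t\<^sup>2 \<le> min (u ^ 3) u" using 1 u by linarith
          then show ?thesis using c by (simp add: c'_def mult.assoc)
        qed
        then have cG: "c' * t\<^sup>2 \<le> G ^ 3" using G by linarith
        have "\<bar>t\<bar> ^ p \<le> \<bar>t\<bar> ^ (2 * (p + 1))" using False by (intro power_increasing) auto
        also have "\<dots> = (t\<^sup>2) ^ (p + 1)" by (simp only: power_mult power2_abs)
        finally have tp: "\<bar>t\<bar> ^ p \<le> (t\<^sup>2) ^ (p + 1)" .
        have "norm (weight n (\<delta> n * t)) * \<bar>t\<bar> ^ p * (1 + t\<^sup>2) \<le> exp (- G) * (t\<^sup>2) ^ (p + 1) * (2 * t\<^sup>2)"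
          using w tp t1 by (intro mult_mono) auto
        also have "\<dots> = 2 * exp (- G) / c' ^ (p + 2) * (c' * t\<^sup>2) ^ (p + 2)"
          using c' by (simp add: power_mult_distrib power_add power2_eq_square)
        also have "\<dots> \<le> 2 * exp (- G) / c' ^ (p + 2) * (G ^ 3) ^ (p + 2)"
          using c' cG by (intro mult_left_mono power_mono) auto
        also have "(G ^ 3) ^ (p + 2) \<le> fact (3 * (p + 2)) * exp G"
          using power_le_fact_exp[OF G(1), of "3 * (p + 2)"] by (simp only: power_mult)
        then have "2 * exp (- G) / c' ^ (p + 2) * (G ^ 3) ^ (p + 2) \<le>
            2 * exp (- G) / c' ^ (p + 2) * (fact (3 * (p + 2)) * exp G)"
          using c' by (intro mult_left_mono) auto
        also have "\<dots> = 2 * (fact (3 * (p + 2)) / c' ^ (p + 2)) * (exp (- G) * exp G)"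
          by simp
        also have "exp (- G) * exp G = 1" by (simp flip: exp_add)
        also have "2 * (fact (3 * (p + 2)) / c' ^ (p + 2)) * 1 \<le> C" by (simp add: C_def)
        finally show ?thesis .
      qed
      then show "norm (weight n (\<delta> n * t)) * \<bar>t\<bar> ^ p \<le> C * inverse (1 + t\<^sup>2)"
        by (simp add: field_simps add_pos_nonneg)
    qed
  qed
  then show ?thesis by blast
qed

end

lemma uniform_limit_sum:
  fixes f :: "'i \<Rightarrow> 'a \<Rightarrow> 'b \<Rightarrow> 'c :: real_normed_vector"
  assumes "\<And>i. i \<in> I \<Longrightarrow> uniform_limit X (f i) (g i) F"
  shows "uniform_limit X (\<lambda>n x. \<Sum>i\<in>I. f i n x) (\<lambda>x. \<Sum>i\<in>I. g i x) F"
  using assms by (induction I rule: infinite_finite_induct) (auto intro!: uniform_limit_intros)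

section \<open>From Cauchy integrals to the Jensen polynomial\<close>

context saddle
begin

text \<open>One circle serves all shifts \<open>m\<close>: passing from \<open>n\<close> to
  \<open>n + m\<close> only inserts the factor \<open>cis (- \<theta>) ^ m\<close> and a power of
  the radius.\<close>

lemma weight_integral:
  assumes "a n > 0"
  shows "((\<lambda>\<theta>. weight n \<theta> * cis (- \<theta>) ^ m) has_integral
    of_real (2 * pi * exp (- a n) ^ (n + m) * num_regular_partitions k (n + m)) / exp (log_gf k (of_real (exp (- a n))))) {-pi..pi}"
proof -
  define r where "r = exp (- a n)"
  have r: "0 < r" "r < 1" using assms by (auto simp: r_def)
  define F where "F = exp (log_gf k (of_real r))"
  have F: "F \<noteq> 0" by (simp add: F_def)
  have "((\<lambda>\<theta>. exp (log_gf k (of_real r * cis \<theta>)) / (of_real r * cis \<theta>) ^ (n + m)) has_integral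
      2 * pi * num_regular_partitions k (n + m)) {-pi..pi}"
    using k r by (intro num_regular_partitions_integral) auto
  from has_integral_mult_right[OF this, of "of_real (r ^ (n + m)) / F"]
  have "((\<lambda>\<theta>. of_real (r ^ (n + m)) / F * (exp (log_gf k (of_real r * cis \<theta>)) / (of_real r * cis \<theta>) ^ (n + m)))
    has_integral of_real (2 * pi * r ^ (n + m) * num_regular_partitions k (n + m)) / F) {-pi..pi}"
    by (simp add: mult_ac)
  moreover have "of_real (r ^ (n + m)) / F * (exp (log_gf k (of_real r * cis \<theta>)) / (of_real r * cis \<theta>) ^ (n + m)) =
      weight n \<theta> * cis (- \<theta>) ^ m" for \<theta>
  proof -
    have "cis (- (n * \<theta>)) * cis (- \<theta>) ^ m = cis (- \<theta>) ^ (n + m)"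
      by (simp add: power_add Complex.DeMoivre)
    also have "\<dots> = 1 / cis \<theta> ^ (n + m)"
      by (simp add: cis_inverse[symmetric] field_simps)
    finally have "weight n \<theta> * cis (- \<theta>) ^ m = exp (log_gf k (of_real r * cis \<theta>)) / F * (1 / cis \<theta> ^ (n + m))"
      by (simp add: weight_def r_def F_def exp_diff mult.assoc)
    then show ?thesis using r by (simp add: power_mult_distrib)
  qed
  ultimately show ?thesis unfolding F_def r_def by simp
qed

text \<open>With \<open>c = cis (- \<theta>)\<close> these are the terms in the expansion of
  \<open>((1 - c) + \<delta> * X * c) ^ d\<close>. On the scale \<delta> each factor
  \<open>1 - c\<close> has order \<delta>, while the powers of \<open>c\<close> tend to 1.\<close>

definition basis :: "nat \<Rightarrow> nat \<Rightarrow> nat \<Rightarrow> real \<Rightarrow> complex" where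
  "basis n m l \<theta> = weight n \<theta> * cis (- \<theta>) ^ m * (1 - cis (- \<theta>)) ^ l"

text \<open>Integrability for \<open>l = 0\<close> comes with the Cauchy integral; one more factor
  \<open>1 - c\<close> gives a difference of two functions with smaller \<open>l\<close>. No
  continuity of \<open>log_gf\<close> enters.\<close>

lemma basis_integrable:
  assumes "a n > 0"
  shows "basis n m l integrable_on {-pi..pi}"
proof (induction l arbitrary: m)
  case 0
  then show ?case
    using weight_integral[OF assms, of m] by (auto simp: basis_def integrable_on_def)
next
  case (Suc l)
  have "basis n m (Suc l) = (\<lambda>\<theta>. basis n m l \<theta> - basis n (Suc m) l \<theta>)"
    by (auto simp: basis_def fun_eq_iff algebra_simps)
  then show ?case using Suc by (simp add: integrable_diff)
qed

text \<open>Substituting \<open>\<theta> = \<delta> n * t\<close> yields one factor \<delta>, and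
  the \<open>l\<close> factors \<open>1 - c\<close> yield the others. The limit is independent of
  \<open>m\<close>.\<close>

lemma basis_integral_tendsto:
  "(\<lambda>n. integral {-pi..pi} (basis n m l) / of_real (\<delta> n ^ Suc l))
     \<longlonglongrightarrow> of_real (sqrt (4 * pi) * hermite_coeff l)"
proof -
  \<comment> \<open>Extension by zero puts all integrands on the whole line, although the interval
    of integration grows with \<open>n\<close>.\<close>
  define f where "f = (\<lambda>n t. if \<bar>\<delta> n * t\<bar> \<le> pi then
    weight n (\<delta> n * t) * cis (- (\<delta> n * t)) ^ m * ((1 - cis (- (\<delta> n * t))) / of_real (\<delta> n)) ^ l else 0)"
  define g where "g = (\<lambda>t. complex_of_real (exp (- t\<^sup>2 / 4)) * (\<i> * of_real t) ^ l)"
  obtain C where C: "\<forall>\<^sub>F n in sequentially. \<forall>t. \<bar>\<delta> n * t\<bar> \<le> pi \<longrightarrow>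
      norm (weight n (\<delta> n * t)) * \<bar>t\<bar> ^ l \<le> C * inverse (1 + t\<^sup>2)"
    using weight_dominated by blast
  have f_int: "\<forall>\<^sub>F n in sequentially. (f n has_integral
      integral {-pi..pi} (basis n m l) / of_real (\<delta> n ^ Suc l)) UNIV"
    using a_pos \<delta>_pos
  proof eventually_elim
    case (elim n)
    have "(basis n m l has_integral integral {-pi..pi} (basis n m l)) (cbox (-pi) pi)"
      using basis_integrable[OF elim(1)] by (simp add: integrable_integral)
    from has_integral_affinity'[OF this elim(2), of 0]
    have "((\<lambda>t. basis n m l (\<delta> n * t)) has_integral integral {-pi..pi} (basis n m l) / of_real (\<delta> n))
        {- pi / \<delta> n..pi / \<delta> n}"
      by (simp add: scaleR_conv_of_real divide_inverse mult_ac)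
    from has_integral_divide[OF this, of "of_real (\<delta> n ^ l)"]
    have "((\<lambda>t. basis n m l (\<delta> n * t) / of_real (\<delta> n ^ l)) has_integral
        integral {-pi..pi} (basis n m l) / of_real (\<delta> n ^ Suc l)) {- pi / \<delta> n..pi / \<delta> n}"
      by (simp add: mult.commute)
    then have "((\<lambda>t. if t \<in> {- pi / \<delta> n..pi / \<delta> n} then basis n m l (\<delta> n * t) / of_real (\<delta> n ^ l) else 0) has_integral
        integral {-pi..pi} (basis n m l) / of_real (\<delta> n ^ Suc l)) UNIV"
      by (simp only: has_integral_restrict_UNIV)
    moreover have "(\<lambda>t. if t \<in> {- pi / \<delta> n..pi / \<delta> n} then basis n m l (\<delta> n * t) / of_real (\<delta> n ^ l) else 0) = f n"
    proof
      fix t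
      have "t \<in> {- pi / \<delta> n..pi / \<delta> n} \<longleftrightarrow> \<bar>\<delta> n * t\<bar> \<le> pi"
        using elim(2) by (auto simp: abs_le_iff field_simps)
      then show "(if t \<in> {- pi / \<delta> n..pi / \<delta> n} then basis n m l (\<delta> n * t) / of_real (\<delta> n ^ l) else 0) = f n t"
        by (simp add: f_def basis_def power_divide)
    qed
    ultimately show ?case by simp
  qed
  have f_bound: "\<forall>\<^sub>F n in sequentially. \<forall>t. norm (f n t) \<le> \<bar>C\<bar> * inverse (1 + t\<^sup>2)"
    using C \<delta>_pos
  proof eventually_elim
    case (elim n)
    show ?case
    proof
      fix t
      show "norm (f n t) \<le> \<bar>C\<bar> * inverse (1 + t\<^sup>2)"
      proof (cases "\<bar>\<delta> n * t\<bar> \<le> pi")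
        case True
        have "norm ((1 - cis (- (\<delta> n * t))) / of_real (\<delta> n)) \<le> \<bar>t\<bar>"
          using norm_one_minus_cis_le[of "- (\<delta> n * t)"] elim(2)
          by (simp add: norm_divide divide_le_eq abs_mult mult.commute)
        then have "norm (f n t) \<le> norm (weight n (\<delta> n * t)) * \<bar>t\<bar> ^ l"
          using True by (auto simp: f_def norm_mult norm_power intro!: mult_left_mono power_mono)
        also have "\<dots> \<le> C * inverse (1 + t\<^sup>2)" using elim True by blast
        also have "\<dots> \<le> \<bar>C\<bar> * inverse (1 + t\<^sup>2)" by (intro mult_right_mono) auto
        finally show ?thesis .
      next
        case False
        then have "f n t = 0" by (simp add: f_def)
        then show ?thesis by simp
      qed
    qed
  qed
  have f_lim: "(\<lambda>n. f n t) \<longlonglongrightarrow> g t" for t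
  proof -
    have \<delta>t: "(\<lambda>n. \<delta> n * t) \<longlonglongrightarrow> 0"
      by (rule tendsto_mult_left_zero[OF \<delta>_tendsto])
    have "(\<lambda>n. \<bar>\<delta> n * t\<bar>) \<longlonglongrightarrow> 0"
      using tendsto_rabs[OF \<delta>t] by simp
    then have ev: "\<forall>\<^sub>F n in sequentially. \<bar>\<delta> n * t\<bar> < pi"
      by (rule order_tendstoD) simp
    have "(\<lambda>n. cis (- (\<delta> n * t))) \<longlonglongrightarrow> cis (- 0)"
      by (intro tendsto_intros \<delta>t)
    then have "(\<lambda>n. weight n (\<delta> n * t) * cis (- (\<delta> n * t)) ^ m * ((1 - cis (- (\<delta> n * t))) / of_real (\<delta> n)) ^ l)
        \<longlonglongrightarrow> of_real (exp (- t\<^sup>2 / 4)) * cis (- 0) ^ m * (\<i> * of_real t) ^ l"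
      by (intro tendsto_mult tendsto_power weight_tendsto tendsto_one_minus_iexp \<delta>_tendsto \<delta>_pos)
    then have "(\<lambda>n. weight n (\<delta> n * t) * cis (- (\<delta> n * t)) ^ m * ((1 - cis (- (\<delta> n * t))) / of_real (\<delta> n)) ^ l)
        \<longlonglongrightarrow> g t"
      by (simp add: g_def)
    moreover have "\<forall>\<^sub>F n in sequentially. f n t =
        weight n (\<delta> n * t) * cis (- (\<delta> n * t)) ^ m * ((1 - cis (- (\<delta> n * t))) / of_real (\<delta> n)) ^ l"
      using ev by eventually_elim (simp add: f_def)
    ultimately show ?thesis by (simp add: filterlim_cong)
  qed
  obtain N where N: "\<And>n. n \<ge> N \<Longrightarrow> (f n has_integral
      integral {-pi..pi} (basis n m l) / of_real (\<delta> n ^ Suc l)) UNIV \<and>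
      (\<forall>t. norm (f n t) \<le> \<bar>C\<bar> * inverse (1 + t\<^sup>2))"
    using eventually_conj[OF f_int f_bound] unfolding eventually_sequentially by auto
  have h: "(\<lambda>t. \<bar>C\<bar> * inverse (1 + t\<^sup>2)) integrable_on (UNIV :: real set)"
  proof -
    have "integrable lborel (\<lambda>t :: real. inverse (1 + t\<^sup>2))"
      using integrable_inverse_1_plus_square by (simp add: set_integrable_def)
    then show ?thesis
      by (intro integrable_on_mult_right) (blast dest: has_integral_integral_lborel)
  qed
  \<comment> \<open>Integrability and domination hold from \<open>N\<close> on, whereas the
    convergence theorem asks for them at every index; hence the shift.\<close>
  have "(\<lambda>n. integral UNIV (f (n + N))) \<longlonglongrightarrow> integral UNIV g"
  proof (rule dominated_convergence(2)[OF _ h])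
    show "f (n + N) integrable_on UNIV" for n using N[of "n + N"] by auto
    show "norm (f (n + N) t) \<le> \<bar>C\<bar> * inverse (1 + t\<^sup>2)" for n t using N[of "n + N"] by auto
    show "(\<lambda>n. f (n + N) t) \<longlonglongrightarrow> g t" for t by (rule LIMSEQ_ignore_initial_segment[OF f_lim])
  qed
  moreover have "integral UNIV (f (n + N)) =
      integral {-pi..pi} (basis (n + N) m l) / of_real (\<delta> (n + N) ^ Suc l)" for n
    using N[of "n + N"] by (intro integral_unique) auto
  ultimately have "(\<lambda>n. integral {-pi..pi} (basis (n + N) m l) / of_real (\<delta> (n + N) ^ Suc l)) \<longlonglongrightarrow> integral UNIV g"
    by simp
  then have "(\<lambda>n. integral {-pi..pi} (basis n m l) / of_real (\<delta> n ^ Suc l)) \<longlonglongrightarrow> integral UNIV g"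
    by (rule LIMSEQ_offset)
  also have "integral UNIV g = of_real (sqrt (4 * pi) * hermite_coeff l)"
  proof (rule integral_unique)
    have "((\<lambda>t. complex_of_real (exp (- t\<^sup>2 / 4) * t ^ l)) has_integral of_real (sqrt (4 * pi) * gauss_moment l)) UNIV"
      by (rule has_integral_of_real[OF gauss_moment_integral])
    from has_integral_mult_right[OF this, of "\<i> ^ l"]
    show "(g has_integral of_real (sqrt (4 * pi) * hermite_coeff l)) UNIV"
      by (simp add: g_def of_real_hermite_coeff power_mult_distrib mult_ac)
  qed
  finally show ?thesis .
qed

text \<open>The denominator stands for p_k(n). Dividing by it cancels the generating function at the
  radius, and numerator and denominator each carry one \<delta> from the substitution.\<close>

definition jensen_coeff :: "nat \<Rightarrow> nat \<Rightarrow> nat \<Rightarrow> complex" where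
  "jensen_coeff d n j = (integral {-pi..pi} (basis n (d - j) j) / of_real (\<delta> n ^ Suc j)) /
     (integral {-pi..pi} (basis n 0 0) / of_real (\<delta> n))"

lemma jensen_coeff_tendsto: "(\<lambda>n. Re (jensen_coeff d n j)) \<longlonglongrightarrow> hermite_coeff j"
proof -
  have "(\<lambda>n. jensen_coeff d n j) \<longlonglongrightarrow>
      of_real (sqrt (4 * pi) * hermite_coeff j) / of_real (sqrt (4 * pi) * hermite_coeff 0)"
    unfolding jensen_coeff_def
    using basis_integral_tendsto[of 0 0] by (intro tendsto_divide basis_integral_tendsto) (auto simp: hermite_coeff_0)
  from tendsto_Re[OF this] show ?thesis by (simp add: hermite_coeff_0)
qed

text \<open>An exact identity for each \<open>n\<close>: all asymptotics sit in the coefficients,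
  which do not depend on \<open>X\<close>.\<close>

lemma jensen_expansion:
  assumes "a n > 0" "\<delta> n > 0"
  shows "\<delta> n powi (- int d) / real (num_regular_partitions k n) *
      poly (jensen_poly (\<lambda>i. real (num_regular_partitions k i)) d n) ((\<delta> n * X - 1) / exp (a n)) =
    (\<Sum>j\<le>d. real (d choose j) * X ^ (d - j) * Re (jensen_coeff d n j))"
proof -
  define r where "r = exp (- a n)"
  define p where "p = (\<lambda>i. real (num_regular_partitions k i))"
  define Q where "Q = complex_of_real (2 * pi * r ^ n) / exp (log_gf k (of_real r))"
  define y where "y = \<delta> n * X - 1"
  define J where "J = poly (jensen_poly p d n) (y / exp (a n))"
  have Q: "Q \<noteq> 0" by (simp add: Q_def r_def)
  have w: "((\<lambda>\<theta>. weight n \<theta> * cis (- \<theta>) ^ m) has_integral Q * of_real (r ^ m * p (n + m))) {-pi..pi}" for m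
    using weight_integral[OF assms(1), of m] by (simp add: Q_def r_def p_def power_add mult_ac)
  have "J = (\<Sum>j\<le>d. real (d choose j) * p (n + j) * (y * r) ^ j)"
    by (simp add: J_def jensen_poly_def poly_sum poly_monom r_def exp_minus divide_inverse atMost_atLeast0)
  then have J: "Q * of_real J = (\<Sum>j\<le>d. of_real (real (d choose j) * y ^ j) * (Q * of_real (r ^ j * p (n + j))))"
    by (simp add: sum_distrib_left power_mult_distrib mult_ac)
  have "((\<lambda>\<theta>. \<Sum>j\<le>d. of_real (real (d choose j) * y ^ j) * (weight n \<theta> * cis (- \<theta>) ^ j)) has_integral Q * of_real J) {-pi..pi}"
    unfolding J by (intro has_integral_sum has_integral_mult_right w) auto
  moreover have "((\<lambda>\<theta>. \<Sum>j\<le>d. of_real (real (d choose j) * (\<delta> n * X) ^ (d - j)) * basis n (d - j) j \<theta>) has_integral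
      (\<Sum>j\<le>d. of_real (real (d choose j) * (\<delta> n * X) ^ (d - j)) * integral {-pi..pi} (basis n (d - j) j))) {-pi..pi}"
    by (intro has_integral_sum has_integral_mult_right integrable_integral basis_integrable assms) auto
  moreover have "(\<Sum>j\<le>d. of_real (real (d choose j) * y ^ j) * (weight n \<theta> * cis (- \<theta>) ^ j)) =
      (\<Sum>j\<le>d. of_real (real (d choose j) * (\<delta> n * X) ^ (d - j)) * basis n (d - j) j \<theta>)" for \<theta>
  proof -
    define c where "c = cis (- \<theta>)"
    have "(\<Sum>j\<le>d. of_real (real (d choose j) * y ^ j) * (weight n \<theta> * c ^ j)) = weight n \<theta> * (of_real y * c + 1) ^ d"
      unfolding binomial_ring by (simp add: sum_distrib_left power_mult_distrib mult_ac)
    \<comment> \<open>The regrouping that resolves the cancellation: both summands carry a factor of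
      order \<delta>, so the \<open>d\<close>-th power absorbs the normalization.\<close>
    also have "of_real y * c + 1 = (1 - c) + of_real (\<delta> n * X) * c"
      by (simp add: y_def algebra_simps)
    also have "weight n \<theta> * \<dots> ^ d = (\<Sum>j\<le>d. of_real (real (d choose j) * (\<delta> n * X) ^ (d - j)) * basis n (d - j) j \<theta>)"
      unfolding binomial_ring by (simp add: basis_def c_def sum_distrib_left power_mult_distrib mult_ac)
    finally show ?thesis by (simp add: c_def)
  qed
  ultimately have "Q * of_real J = (\<Sum>j\<le>d. of_real (real (d choose j) * (\<delta> n * X) ^ (d - j)) * integral {-pi..pi} (basis n (d - j) j))"
    by (simp add: has_integral_unique)
  also have "\<dots> = (\<Sum>j\<le>d. of_real (\<delta> n ^ Suc d) * (of_real (real (d choose j) * X ^ (d - j)) *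
      (integral {-pi..pi} (basis n (d - j) j) / of_real (\<delta> n ^ Suc j))))"
  proof (intro sum.cong refl)
    fix j assume "j \<in> {..d}"
    then have "\<delta> n ^ Suc d = \<delta> n ^ (d - j) * \<delta> n ^ Suc j"
      by (simp flip: power_add)
    then show "of_real (real (d choose j) * (\<delta> n * X) ^ (d - j)) * integral {-pi..pi} (basis n (d - j) j) =
      of_real (\<delta> n ^ Suc d) * (of_real (real (d choose j) * X ^ (d - j)) *
      (integral {-pi..pi} (basis n (d - j) j) / of_real (\<delta> n ^ Suc j)))"
      using assms by (simp add: power_mult_distrib)
  qed
  finally have QJ: "Q * of_real J = of_real (\<delta> n ^ Suc d) * (\<Sum>j\<le>d. of_real (real (d choose j) * X ^ (d - j)) *
      (integral {-pi..pi} (basis n (d - j) j) / of_real (\<delta> n ^ Suc j)))"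
    by (simp only: sum_distrib_left)
  have "basis n 0 0 = (\<lambda>\<theta>. weight n \<theta> * cis (- \<theta>) ^ 0)"
    by (simp add: basis_def fun_eq_iff)
  then have Qp: "integral {-pi..pi} (basis n 0 0) = Q * of_real (p n)"
    using integral_unique[OF w[of 0]] by simp
  have \<delta>0: "complex_of_real (\<delta> n ^ Suc d) \<noteq> 0" using assms by simp
  have "of_real (\<delta> n powi (- int d) / p n * J) = (Q * of_real J) / of_real (\<delta> n ^ Suc d) / (Q * of_real (p n) / of_real (\<delta> n))"
    using Q assms by (simp add: power_int_minus field_simps)
  also have "\<dots> = (\<Sum>j\<le>d. of_real (real (d choose j) * X ^ (d - j)) * jensen_coeff d n j)"
    unfolding QJ jensen_coeff_def Qp
    by (simp only: nonzero_mult_div_cancel_left[OF \<delta>0] sum_divide_distrib times_divide_eq_right)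
  finally have "\<delta> n powi (- int d) / p n * J = Re (\<Sum>j\<le>d. of_real (real (d choose j) * X ^ (d - j)) * jensen_coeff d n j)"
    by (metis Re_complex_of_real)
  also have "\<dots> = (\<Sum>j\<le>d. real (d choose j) * X ^ (d - j) * Re (jensen_coeff d n j))"
    unfolding Re_sum by (intro sum.cong refl) (simp del: of_real_mult of_real_power)
  finally show ?thesis by (simp add: J_def p_def y_def)
qed

text \<open>The functions are polynomials in \<open>X\<close> of degree at most \<open>d\<close>
  with convergent coefficients, so convergence is uniform on bounded sets.\<close>

lemma jensen_uniform_limit:
  assumes "bounded K"
  shows "uniform_limit K (\<lambda>n X. \<delta> n powi (- int d) / real (num_regular_partitions k n) *
      poly (jensen_poly (\<lambda>i. real (num_regular_partitions k i)) d n) ((\<delta> n * X - 1) / exp (a n)))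
    (\<lambda>X. hermite d X) sequentially"
proof -
  have term_lim: "uniform_limit K (\<lambda>n X. real (d choose j) * X ^ (d - j) * Re (jensen_coeff d n j))
      (\<lambda>X. real (d choose j) * X ^ (d - j) * hermite_coeff j) sequentially" for j
  proof (rule uniform_lim_mult)
    show "uniform_limit K (\<lambda>n X. real (d choose j) * X ^ (d - j)) (\<lambda>X. real (d choose j) * X ^ (d - j)) sequentially"
      by (rule uniform_limit_const)
    show "uniform_limit K (\<lambda>n X. Re (jensen_coeff d n j)) (\<lambda>X. hermite_coeff j) sequentially"
      using jensen_coeff_tendsto[of d j] by (intro uniform_limitI) (auto dest: tendstoD)
    obtain B where B: "\<And>X. X \<in> K \<Longrightarrow> \<bar>X\<bar> \<le> B"
      using assms unfolding bounded_iff by auto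
    have "norm (real (d choose j) * X ^ (d - j)) \<le> real (d choose j) * B ^ (d - j)" if "X \<in> K" for X
      using B[OF that] by (auto simp: abs_mult power_abs intro!: mult_left_mono power_mono)
    then show "bounded ((\<lambda>X. real (d choose j) * X ^ (d - j)) ` K)"
      by (intro boundedI[of _ "real (d choose j) * B ^ (d - j)"]) auto
    show "bounded ((\<lambda>X. hermite_coeff j) ` K)"
      by (rule finite_imp_bounded, rule finite_subset[of _ "{hermite_coeff j}"]) auto
  qed
  have "uniform_limit K (\<lambda>n X. \<Sum>j\<le>d. real (d choose j) * X ^ (d - j) * Re (jensen_coeff d n j))
      (\<lambda>X. \<Sum>j\<le>d. real (d choose j) * X ^ (d - j) * hermite_coeff j) sequentially"
    by (rule uniform_limit_sum) (rule term_lim)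
  then have "uniform_limit K (\<lambda>n X. \<Sum>j\<le>d. real (d choose j) * X ^ (d - j) * Re (jensen_coeff d n j))
      (\<lambda>X. hermite d X) sequentially"
    by (simp add: hermite_eq_sum)
  moreover have "\<forall>\<^sub>F n in sequentially. \<forall>X\<in>K. (\<Sum>j\<le>d. real (d choose j) * X ^ (d - j) * Re (jensen_coeff d n j)) =
      \<delta> n powi (- int d) / real (num_regular_partitions k n) *
      poly (jensen_poly (\<lambda>i. real (num_regular_partitions k i)) d n) ((\<delta> n * X - 1) / exp (a n))"
    using a_pos \<delta>_pos by eventually_elim (intro ballI jensen_expansion[symmetric])
  ultimately show ?thesis
    by (rule uniform_limit_cong[THEN iffD1, rotated 2]) auto
qed

end

section \<open>The scaling sequences\<close>

text \<open>Consequently 2 \<pi> sqrt(m_k/n), the leading term of \<open>A_seq k d n\<close>, is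
  exactly the saddle point sqrt(\<kappa>/n).\<close>

lemma log_gf_leading_eq: "k \<ge> 2 \<Longrightarrow> log_gf_leading k = (2 * pi * sqrt (m_const k))\<^sup>2"
  by (simp add: log_gf_leading_def m_const_def power_mult_distrib field_simps)

lemma m_const_pos: "k \<ge> 2 \<Longrightarrow> m_const k > 0"
  by (simp add: m_const_def)

text \<open>The series is the binomial expansion of sqrt(n+1) without its first two terms; it is
  summed for \<open>n \<ge> 2\<close>, where \<open>1 < n\<close> gives convergence.\<close>

lemma delta_seq_eq:
  assumes "n \<ge> 2"
  shows "delta_seq k n = sqrt (4 * pi * sqrt (m_const k) * (sqrt n + 1 / (2 * sqrt n) - sqrt (n + 1)))"
proof -
  have "(\<lambda>r. ((1/2) gchoose r) * real n powr (1/2 - real r) * 1 ^ r) sums sqrt (real n + 1)"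
    by (rule sqrt_series') (use assms in auto)
  then have "(\<lambda>r. ((1/2) gchoose (r + 2)) * real n powr (1/2 - real (r + 2))) sums
      (sqrt (real n + 1) - (\<Sum>r<2. ((1/2) gchoose r) * real n powr (1/2 - real r)))"
    by (subst sums_iff_shift) simp
  also have "(\<Sum>r<2. ((1/2) gchoose r) * real n powr (1/2 - real r)) = sqrt n + 1 / (2 * sqrt n)"
    using assms by (simp add: numeral_2_eq_2 powr_half_sqrt powr_minus_divide)
  finally have "(\<lambda>r. 4 * pi * sqrt (m_const k) * (((1/2) gchoose (r + 2)) * real n powr (1/2 - real (r + 2)))) sums
      (4 * pi * sqrt (m_const k) * (sqrt (real n + 1) - (sqrt n + 1 / (2 * sqrt n))))"
    by (rule sums_mult)
  moreover have "4 * pi * sqrt (m_const k) * (((1/2) gchoose (r + 2)) * real n powr (1/2 - real (r + 2))) =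
      4 * pi * sqrt (m_const k) * ((1/2) gchoose (r + 2)) / real n powr (real (r + 2) - 1/2)" for r
    using powr_minus_divide[of "real n" "real (r + 2) - 1/2"] by (simp add: mult_ac)
  ultimately have "(\<Sum>r. 4 * pi * sqrt (m_const k) * ((1/2) gchoose (r + 2)) / real n powr (real (r + 2) - 1/2)) =
      4 * pi * sqrt (m_const k) * (sqrt (real n + 1) - (sqrt n + 1 / (2 * sqrt n)))"
    by (simp only: sums_iff)
  then show ?thesis
    unfolding delta_seq_def by (simp add: algebra_simps)
qed

text \<open>The leading constant is governed by \<open>1 / 8\<close>, the negative of
  \<open>(1/2) gchoose 2\<close>, the first coefficient of the series.\<close>

lemma delta_seq_scaled:
  assumes "k \<ge> 2"
  shows "(\<lambda>n. real n powr (3 / 2) * (delta_seq k n)\<^sup>2) \<longlonglongrightarrow> pi * sqrt (m_const k) / 2"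
    and "\<forall>\<^sub>F n in sequentially. delta_seq k n > 0"
    and "(\<lambda>n. real n powr (3 / 4) * delta_seq k n) \<longlonglongrightarrow> sqrt (pi * sqrt (m_const k) / 2)"
proof -
  define g where "g = (\<lambda>n. sqrt (real n) + 1 / (2 * sqrt n) - sqrt (n + 1))"
  have "(\<lambda>n. real n powr (3 / 2) * g n) \<longlonglongrightarrow> 1 / 8"
    unfolding g_def by real_asymp
  then have "(\<lambda>n. 4 * pi * sqrt (m_const k) * (real n powr (3 / 2) * g n)) \<longlonglongrightarrow> 4 * pi * sqrt (m_const k) * (1 / 8)"
    by (rule tendsto_mult_left)
  then have lim: "(\<lambda>n. 4 * pi * sqrt (m_const k) * (real n powr (3 / 2) * g n)) \<longlonglongrightarrow> pi * sqrt (m_const k) / 2"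
    by simp
  have pos: "\<forall>\<^sub>F n in sequentially. g n > 0"
    unfolding g_def by real_asymp
  have ev: "\<forall>\<^sub>F n in sequentially. 0 < delta_seq k n \<and> (delta_seq k n)\<^sup>2 = 4 * pi * sqrt (m_const k) * g n"
    using pos eventually_ge_at_top[of 2]
  proof eventually_elim
    case (elim n)
    then show ?case
      using delta_seq_eq[of n k] m_const_pos[OF assms] by (simp add: g_def)
  qed
  show "\<forall>\<^sub>F n in sequentially. delta_seq k n > 0"
    using ev by eventually_elim simp
  show sq: "(\<lambda>n. real n powr (3 / 2) * (delta_seq k n)\<^sup>2) \<longlonglongrightarrow> pi * sqrt (m_const k) / 2"
    by (rule Lim_transform_eventually[OF lim]) (use ev in \<open>eventually_elim, simp\<close>)
  have "(\<lambda>n. sqrt (real n powr (3 / 2) * (delta_seq k n)\<^sup>2)) \<longlonglongrightarrow> sqrt (pi * sqrt (m_const k) / 2)"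
    by (rule tendsto_real_sqrt[OF sq])
  moreover have "\<forall>\<^sub>F n in sequentially. sqrt (real n powr (3 / 2) * (delta_seq k n)\<^sup>2) = real n powr (3 / 4) * delta_seq k n"
    using ev
  proof eventually_elim
    case (elim n)
    have "sqrt (real n powr (3 / 2)) = real n powr (3 / 4)"
      by (simp add: powr_powr flip: powr_half_sqrt)
    then show ?case using conjunct1[OF elim] by (simp add: real_sqrt_mult)
  qed
  ultimately show "(\<lambda>n. real n powr (3 / 4) * delta_seq k n) \<longlonglongrightarrow> sqrt (pi * sqrt (m_const k) / 2)"
    by (rule Lim_transform_eventually)
qed

text \<open>Every correction term is O(1/n), while \<delta> has order n^(-3/4). The corrections
  therefore displace the radius by o(\<delta>), which is what \<open>balance\<close>
  tolerates.\<close>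

lemma A_seq_error:
  "(\<lambda>n. real n powr (3 / 4) * (A_seq k d n - 2 * pi * sqrt (m_const k / n))) \<longlonglongrightarrow> 0"
proof -
  have *: "(\<lambda>n. real n powr (3 / 4) * ((- 1) ^ r / (real r * real n ^ r))) \<longlonglongrightarrow> 0" if "r \<ge> 1" for r
  proof (rule Lim_null_comparison)
    show "\<forall>\<^sub>F n in sequentially. norm (real n powr (3 / 4) * ((- 1) ^ r / (real r * real n ^ r))) \<le> real n powr (3 / 4) / real n"
      using eventually_ge_at_top[of 1]
    proof eventually_elim
      case (elim n)
      have "1 * real n ^ 1 \<le> real r * real n ^ r"
        using that elim by (intro mult_mono power_increasing) auto
      then have "real n powr (3 / 4) / (real r * real n ^ r) \<le> real n powr (3 / 4) / real n"
        using elim that by (intro divide_left_mono mult_pos_pos) auto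
      then show ?case by (simp add: abs_mult power_abs)
    qed
    show "(\<lambda>n. real n powr (3 / 4) / real n) \<longlonglongrightarrow> 0"
      by real_asymp
  qed
  have "(\<lambda>n. \<Sum>r = 1..(3 * d) div 4. real n powr (3 / 4) * ((- 1) ^ r / (real r * real n ^ r))) \<longlonglongrightarrow> 0"
    by (rule tendsto_null_sum) (use * in auto)
  then have "(\<lambda>n. 3 / 4 * (\<Sum>r = 1..(3 * d) div 4. real n powr (3 / 4) * ((- 1) ^ r / (real r * real n ^ r)))) \<longlonglongrightarrow> 0"
    by (rule tendsto_mult_right_zero)
  then show ?thesis
    by (simp add: A_seq_def sum_distrib_left mult_ac)
qed

lemma saddle_regular_partitions:
  assumes k: "k \<ge> 2"
  shows "saddle k (A_seq k d) (delta_seq k)"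
proof -
  define b0 where "b0 = 2 * pi * sqrt (m_const k)"
  have b0: "b0 > 0" using m_const_pos[OF k] by (simp add: b0_def)
  \<comment> \<open>Rescaling by \<open>sqrt n\<close> makes the radius parameter converge to the
    positive limit \<open>b0\<close>, the square root of \<open>log_gf_leading k\<close>.\<close>
  define b where "b = (\<lambda>n. sqrt (real n) * A_seq k d n)"
  define e where "e = (\<lambda>n. A_seq k d n - 2 * pi * sqrt (m_const k / n))"
  have b_eq: "b n = b0 + sqrt n * e n" if "n > 0" for n
    using that by (simp add: b_def e_def b0_def algebra_simps real_sqrt_divide)
  have e34: "(\<lambda>n. real n powr (3 / 4) * e n) \<longlonglongrightarrow> 0"
    unfolding e_def by (rule A_seq_error)
  have "(\<lambda>n. real n powr (- 1 / 4)) \<longlonglongrightarrow> 0" by real_asymp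
  then have "(\<lambda>n. b0 + real n powr (- 1 / 4) * (real n powr (3 / 4) * e n)) \<longlonglongrightarrow> b0 + 0 * 0"
    by (intro tendsto_intros e34)
  moreover have "\<forall>\<^sub>F n in sequentially. b0 + real n powr (- 1 / 4) * (real n powr (3 / 4) * e n) = b n"
    using eventually_gt_at_top[of 0]
    by eventually_elim (simp add: b_eq powr_half_sqrt mult.assoc[symmetric] flip: powr_add)
  ultimately have b: "b \<longlonglongrightarrow> b0"
    using Lim_transform_eventually by fastforce
  have b_pos: "\<forall>\<^sub>F n in sequentially. b n > 0"
    using b b0 by (rule order_tendstoD)
  have A: "A_seq k d n = b n / sqrt n" if "n > 0" for n
    using that by (simp add: b_def)
  show ?thesis
  proof
    show "\<forall>\<^sub>F n in sequentially. 0 < A_seq k d n"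
      using b_pos eventually_gt_at_top[of 0] by eventually_elim (simp add: A)
    have "(\<lambda>n. 1 / sqrt (real n)) \<longlonglongrightarrow> 0" by real_asymp
    then have "(\<lambda>n. b n * (1 / sqrt n)) \<longlonglongrightarrow> b0 * 0"
      by (intro tendsto_mult b)
    moreover have "\<forall>\<^sub>F n in sequentially. b n * (1 / sqrt n) = A_seq k d n"
      using eventually_gt_at_top[of 0] by eventually_elim (simp add: A)
    ultimately show "A_seq k d \<longlonglongrightarrow> 0"
      using Lim_transform_eventually by fastforce
    have "(\<lambda>n. real n powr (3 / 2) * (delta_seq k n)\<^sup>2 / b n ^ 3) \<longlonglongrightarrow> pi * sqrt (m_const k) / 2 / b0 ^ 3"
      using b0 by (intro tendsto_intros delta_seq_scaled k b) auto
    moreover have "pi * sqrt (m_const k) / 2 / b0 ^ 3 = 1 / (4 * log_gf_leading k)"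
      using m_const_pos[OF k] unfolding log_gf_leading_eq[OF k] b0_def
      by (simp add: power2_eq_square power3_eq_cube field_simps)
    moreover have "\<forall>\<^sub>F n in sequentially. real n powr (3 / 2) * (delta_seq k n)\<^sup>2 / b n ^ 3 = (delta_seq k n)\<^sup>2 / A_seq k d n ^ 3"
      using eventually_gt_at_top[of 0]
    proof eventually_elim
      case (elim n)
      have "sqrt n ^ 3 = (real n powr (1 / 2)) powr (real 3)"
        using elim by (subst powr_realpow) (auto simp: powr_half_sqrt)
      also have "\<dots> = real n powr (3 / 2)" by (simp add: powr_powr)
      finally show ?case using elim by (simp add: A power_divide)
    qed
    ultimately show "(\<lambda>n. (delta_seq k n)\<^sup>2 / A_seq k d n ^ 3) \<longlonglongrightarrow> 1 / (4 * log_gf_leading k)"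
      using Lim_transform_eventually by fastforce
    \<comment> \<open>With \<open>A_seq k d n = b n / sqrt n\<close> the deviation from the saddle
      is \<open>n * (b0^2 - (b n)^2) / (b n)^2\<close>, and
      \<open>b0 - b n = - sqrt n * e n\<close>. The power \<open>n * sqrt n\<close> is shared
      equally: one factor \<open>n powr (3 / 4)\<close> keeps \<delta> bounded, the other still
      sends \<open>e n\<close> to 0.\<close>
    have "(\<lambda>n. (real n powr (3 / 4) * delta_seq k n) * (- (real n powr (3 / 4) * e n)) * (b0 + b n) / (b n)\<^sup>2) \<longlonglongrightarrow>
        sqrt (pi * sqrt (m_const k) / 2) * (- 0) * (b0 + b0) / b0\<^sup>2"
      using b0 by (intro tendsto_intros delta_seq_scaled k b e34) auto
    moreover have "\<forall>\<^sub>F n in sequentially.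
        (real n powr (3 / 4) * delta_seq k n) * (- (real n powr (3 / 4) * e n)) * (b0 + b n) / (b n)\<^sup>2 =
        delta_seq k n * (log_gf_leading k / (A_seq k d n)\<^sup>2 - n)"
      using eventually_gt_at_top[of 0] b_pos
    proof eventually_elim
      case (elim n)
      have p: "real n powr (3 / 4) * real n powr (3 / 4) = real n * sqrt n"
      proof -
        have "real n powr (3 / 4) * real n powr (3 / 4) = real n powr (1 + 1 / 2)"
          by (simp flip: powr_add)
        then show ?thesis
          unfolding powr_add by (simp add: powr_half_sqrt)
      qed
      have "log_gf_leading k / (A_seq k d n)\<^sup>2 - n = n * ((b0\<^sup>2 - (b n)\<^sup>2) / (b n)\<^sup>2)"
        using elim unfolding log_gf_leading_eq[OF k] b0_def[symmetric]
        by (simp add: A power_divide field_simps)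
      also have "b0\<^sup>2 - (b n)\<^sup>2 = - (sqrt n * e n) * (b0 + b n)"
        using elim by (simp add: b_eq power2_eq_square algebra_simps)
      also have "n * (- (sqrt n * e n) * (b0 + b n) / (b n)\<^sup>2) =
          (real n powr (3 / 4) * real n powr (3 / 4)) * (- e n * (b0 + b n) / (b n)\<^sup>2)"
        unfolding p by simp
      finally show ?case by (simp only:) (simp add: mult_ac)
    qed
    ultimately show "(\<lambda>n. delta_seq k n * (log_gf_leading k / (A_seq k d n)\<^sup>2 - n)) \<longlonglongrightarrow> 0"
      using Lim_transform_eventually by fastforce
  qed (use k delta_seq_scaled in auto)
qed

theorem theorem1p19:
  fixes k d :: nat and K :: "real set"
  assumes "k \<ge> 2" and "d \<ge> 1" and "compact K"
  shows "uniform_limit K (\<lambda>n X. renormalized_jensen k d n X) (\<lambda>X. hermite d X) sequentially"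
proof -
  interpret saddle k "A_seq k d" "delta_seq k"
    by (rule saddle_regular_partitions[OF assms(1)])
  show ?thesis
    unfolding renormalized_jensen_def
    by (rule jensen_uniform_limit[OF compact_imp_bounded[OF assms(3)]])
qed

end
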